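(* Let $(\mathcal M,\rho)$ be a finite pseudometric space, and let $F$ be a set-valued mapping assigning to each $x\in\mathcal M$ a nonempty convex closed set $F(x)\subset\mathbb R^2$. Let $\tilde\lambda,\lambda\ge0$, and assume that for every $x,x',x'',y,y',y''\in\mathcal M$ $$\mathcal W_F[x,x',x'':\tilde\lambda]\cap\{\mathcal W_F[y,y',y'':\tilde\lambda]+\lambda\,\rho(x,y)\,Q_0\}\ne\emptyset .$$ Then the $\vec\lambda$-Projection Algorithm with $\vec\lambda=(\tilde\lambda,\lambda)$ produces the outcome "Success" and returns a mapping $f_{\vec\lambda;F}:\mathcal M\to\mathbb R^2$ which is a Lipschitz selection of $F$ with $\|f_{\vec\lambda;F}\|_{\mathrm{Lip}(\mathcal M)}\le2\lambda+\tilde\lambda$.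
   Context: A pseudometric on $\mathcal M$ is a function $\rho:\mathcal M\times\mathcal M\to[0,+\infty]$ with $\rho(x,x)=0$, $\rho(x,y)=\rho(y,x)$ and $\rho(x,y)\le\rho(x,z)+\rho(z,y)$ (zero distance between distinct points and the value $+\infty$ are allowed); "finite pseudometric space" means $\mathcal M$ is finite. $\|\cdot\|$ is the uniform norm on $\mathbb R^2$, $Q_0=[-1,1]^2$, $Q(a,r)=\{y:\|y-a\|\le r\}$, $A+B$ is the Minkowski sum (so $\emptyset+B=\emptyset$). If $\rho(x,y)=+\infty$ then for every $\lambda\ge0$, $A+\lambda\rho(x,y)Q_0=\mathbb R^2$ for nonempty $A$ (and $=\emptyset$ for $A=\emptyset$), and the inequality $\|f(x)-f(y)\|\le\lambda\rho(x,y)$ is no constraint. $\|f\|_{\mathrm{Lip}(\mathcal M)}=\inf\{\lambda\ge0:\|f(x)-f(y)\|\le\lambda\rho(x,y)\ \forall x,y\in\mathcal M\}$; a Lipschitz selection of $F$ is a map $f:\mathcal M\to\mathbb R^2$ with $f(x)\in F(x)$ for all $x$ and $\|f\|_{\mathrm{Lip}(\mathcal M)}<\infty$. A rectangle is a set $I_1\times I_2$ with $I_1,I_2\subset\mathbb R$ nonempty closed intervals (points and unbounded intervals allowed). For a nonempty convex $S\subset\mathbb R^2$, $\mathcal H[S]$ is the smallest closed rectangle containing $S$; $\mathcal H[\emptyset]=\emptyset$. For nonempty closed convex $S$, $\mathbf{Pr}(a,S)=S\cap Q(a,\mathrm{dist}(a,S))$ is the metric projection in the uniform norm (identified with its element when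 it is a singleton). $O=(0,0)$. For $\lambda\ge0$, $x,x',x''\in\mathcal M$, $$\mathcal W_F[x,x',x'':\lambda]=\mathcal H\big[\{F(x')+\lambda\rho(x',x)Q_0\}\cap\{F(x'')+\lambda\rho(x'',x)Q_0\}\big].$$ The $\vec\lambda$-Projection Algorithm, $\vec\lambda=(\lambda_1,\lambda_2)$: Step 1: for $x\in\mathcal M$ let $F^{[1]}[x:\lambda_1]=\bigcap_{y\in\mathcal M}[F(y)+\lambda_1\rho(x,y)Q_0]$; if empty for some $x$, the outcome is "No go" and the algorithm stops. Step 2: let $\mathcal T_{F,\lambda_1}(x)=\mathcal H[F^{[1]}[x:\lambda_1]]$. Step 3: let $\mathcal T^{[1]}_{F,\lambda_1}[x:\lambda_2]=\bigcap_{y\in\mathcal M}[\mathcal T_{F,\lambda_1}(y)+\lambda_2\rho(x,y)Q_0]$; if empty for some $x$, the outcome is "No go" and the algorithm stops. Step 4: let $g_F(x)$ be the center of $\mathbf{Pr}(O,\mathcal T^{[1]}_{F,\lambda_1}[x:\lambda_2])$ (a point or a bounded segment parallel to a coordinate axis). Step 5: let $f_{\vec\lambda;F}(x)=\mathbf{Pr}(g_F(x),F^{[1]}[x:\lambda_1])$; the outcome is "Success" and $f_{\vec\lambda;F}$ is returned. *)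

theory Defs
  imports "HOL-Analysis.Analysis" "HOL-Library.Set_Algebras"
begin

type_synonym plane = "real \<times> real"

text \<open>The uniform norm on the plane is the library's \<^const>\<open>infnorm\<close>; the sum of two sets is
  the Minkowski sum of \<^theory>\<open>HOL-Library.Set_Algebras\<close>.  The topology (hence closedness) of
  \<^typ>\<open>real \<times> real\<close> does not depend on the choice of norm.\<close>

lemma infnorm_plane: "infnorm (p :: plane) = max \<bar>fst p\<bar> \<bar>snd p\<bar>"
proof -
  have "{\<bar>p \<bullet> i\<bar> |i. i \<in> (Basis :: plane set)} = {\<bar>fst p\<bar>, \<bar>snd p\<bar>}"
    by (force simp: Basis_prod_def inner_prod_def)
  then show ?thesis
    by (simp add: infnorm_def cSup_eq_Max sup_max)
qed

definition ext_pseudometric_on :: "'a set \<Rightarrow> ('a \<Rightarrow> 'a \<Rightarrow> ennreal) \<Rightarrow> bool" where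
  "ext_pseudometric_on M \<rho> \<longleftrightarrow>
     (\<forall>x\<in>M. \<rho> x x = 0) \<and>
     (\<forall>x\<in>M. \<forall>y\<in>M. \<rho> x y = \<rho> y x) \<and>
     (\<forall>x\<in>M. \<forall>y\<in>M. \<forall>z\<in>M. \<rho> x y \<le> \<rho> x z + \<rho> z y)"

text \<open>The product of a real \<open>l \<ge> 0\<close> with an extended distance.  An infinite distance
  imposes no constraint even for \<open>l = 0\<close>, whereas \<open>0 * \<infinity> = 0\<close> in \<^typ>\<open>ennreal\<close>.\<close>

definition scaled :: "real \<Rightarrow> ennreal \<Rightarrow> ennreal" where
  "scaled l r = (if r = \<infinity> then \<infinity> else ennreal l * r)"

definition Q0 :: "plane set" where
  "Q0 = {-1..1} \<times> {-1..1}"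

text \<open>The square \<open>t Q0\<close>.  For \<open>t = \<infinity>\<close> it is the whole plane, so that adding it to a nonempty
  set gives the plane and adding it to the empty set gives the empty set.\<close>

definition scaled_Q0 :: "ennreal \<Rightarrow> plane set" where
  "scaled_Q0 t = (if t = \<infinity> then UNIV else (\<lambda>p. enn2real t *\<^sub>R p) ` Q0)"

definition square :: "plane \<Rightarrow> real \<Rightarrow> plane set" where
  "square a r = {y. infnorm (y - a) \<le> r}"

definition lip_norm :: "'a set \<Rightarrow> ('a \<Rightarrow> 'a \<Rightarrow> ennreal) \<Rightarrow> ('a \<Rightarrow> plane) \<Rightarrow> ennreal" where
  "lip_norm M \<rho> f =
     Inf {ennreal l |l. 0 \<le> l \<and> (\<forall>x\<in>M. \<forall>y\<in>M. ennreal (infnorm (f x - f y)) \<le> scaled l (\<rho> x y))}"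

definition lipschitz_selection ::
    "'a set \<Rightarrow> ('a \<Rightarrow> 'a \<Rightarrow> ennreal) \<Rightarrow> ('a \<Rightarrow> plane set) \<Rightarrow> ('a \<Rightarrow> plane) \<Rightarrow> bool" where
  "lipschitz_selection M \<rho> F f \<longleftrightarrow> (\<forall>x\<in>M. f x \<in> F x) \<and> lip_norm M \<rho> f < \<infinity>"

definition is_rectangle :: "plane set \<Rightarrow> bool" where
  "is_rectangle R \<longleftrightarrow>
     (\<exists>I1 I2 :: real set. I1 \<noteq> {} \<and> closed I1 \<and> is_interval I1 \<and>
        I2 \<noteq> {} \<and> closed I2 \<and> is_interval I2 \<and> R = I1 \<times> I2)"

definition rect_hull :: "plane set \<Rightarrow> plane set" where
  "rect_hull S = (if S = {} then {} else is_rectangle hull S)"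

text \<open>The intersection taken by \<^const>\<open>hull\<close> is indeed the smallest rectangle containing \<open>S\<close>;
  minimality is the library fact \<open>hull_minimal\<close>.\<close>

lemma is_rectangle_rect_hull:
  assumes "S \<noteq> {}"
  shows "is_rectangle (rect_hull S)" and "S \<subseteq> rect_hull S"
proof -
  define J :: "real set \<Rightarrow> real set"
    where "J X = \<Inter>{I. closed I \<and> is_interval I \<and> X \<subseteq> I}" for X
  have J: "closed (J X)" "X \<subseteq> J X" for X
    unfolding J_def by auto
  have JI: "is_interval (J X)" for X
    unfolding J_def is_interval_1 by blast
  have sub: "S \<subseteq> J (fst ` S) \<times> J (snd ` S)"
    using J(2)[of "fst ` S"] J(2)[of "snd ` S"] by force
  have rect: "is_rectangle (J (fst ` S) \<times> J (snd ` S))"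
    unfolding is_rectangle_def using assms J JI sub by (intro exI[of _ "J (fst ` S)"] exI[of _ "J (snd ` S)"]) auto
  have "J (fst ` S) \<times> J (snd ` S) \<subseteq> R" if "is_rectangle R" "S \<subseteq> R" for R
  proof -
    obtain I1 I2 where I: "closed I1" "is_interval I1" "closed I2" "is_interval I2" "R = I1 \<times> I2"
      using \<open>is_rectangle R\<close> unfolding is_rectangle_def by blast
    have "fst ` S \<subseteq> I1" "snd ` S \<subseteq> I2"
      using \<open>S \<subseteq> R\<close> I(5) by auto
    then have "J (fst ` S) \<subseteq> I1" "J (snd ` S) \<subseteq> I2"
      unfolding J_def using I by auto
    then show ?thesis
      using I(5) by auto
  qed
  then have "is_rectangle hull S = J (fst ` S) \<times> J (snd ` S)"
    using sub rect by (intro hull_unique) auto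
  then show "is_rectangle (rect_hull S)" "S \<subseteq> rect_hull S"
    using assms rect sub by (simp_all add: rect_hull_def)
qed

definition unif_dist :: "plane \<Rightarrow> plane set \<Rightarrow> real" where
  "unif_dist a S = (INF s\<in>S. infnorm (a - s))"

text \<open>The metric projection in the uniform norm, as a set.\<close>

definition Pr :: "plane \<Rightarrow> plane set \<Rightarrow> plane set" where
  "Pr a S = S \<inter> square a (unif_dist a S)"

text \<open>\<open>S\<close> is a point or a bounded segment parallel to a coordinate axis, and \<open>c\<close> is its center.\<close>

definition axis_segment_center :: "plane set \<Rightarrow> plane \<Rightarrow> bool" where
  "axis_segment_center S c \<longleftrightarrow>
     (\<exists>a b. S = closed_segment a b \<and> (fst a = fst b \<or> snd a = snd b) \<and> c = midpoint a b)"

definition W ::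
    "('a \<Rightarrow> 'a \<Rightarrow> ennreal) \<Rightarrow> ('a \<Rightarrow> plane set) \<Rightarrow> real \<Rightarrow> 'a \<Rightarrow> 'a \<Rightarrow> 'a \<Rightarrow> plane set" where
  "W \<rho> F l x x' x'' =
     rect_hull ((F x' + scaled_Q0 (scaled l (\<rho> x' x))) \<inter> (F x'' + scaled_Q0 (scaled l (\<rho> x'' x))))"

text \<open>The balanced refinement of a set-valued mapping; used for \<open>F\<close> in Step 1 and for the
  rectangles of Step 2 in Step 3.\<close>

definition refinement ::
    "'a set \<Rightarrow> ('a \<Rightarrow> 'a \<Rightarrow> ennreal) \<Rightarrow> ('a \<Rightarrow> plane set) \<Rightarrow> real \<Rightarrow> 'a \<Rightarrow> plane set" where
  "refinement M \<rho> F l x = (\<Inter>y\<in>M. F y + scaled_Q0 (scaled l (\<rho> x y)))"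

definition step2_rect ::
    "'a set \<Rightarrow> ('a \<Rightarrow> 'a \<Rightarrow> ennreal) \<Rightarrow> ('a \<Rightarrow> plane set) \<Rightarrow> real \<Rightarrow> 'a \<Rightarrow> plane set" where
  "step2_rect M \<rho> F l x = rect_hull (refinement M \<rho> F l x)"

datatype 'a outcome = No_go | Success "'a \<Rightarrow> plane"

text \<open>\<open>proj_algorithm M \<rho> F l1 l2 out\<close> means that the projection algorithm with parameters
  \<open>(l1, l2)\<close> has the outcome \<open>out\<close>.  In \<open>success\<close>, the center in Step 4 must exist and the
  projection in Step 5 must be a single point, the value \<open>f x\<close>; no choice is made for sets of
  other shapes.  This determines \<open>f\<close> on \<open>M\<close>; outside \<open>M\<close> its values are irrelevant.\<close>

inductive proj_algorithm ::
    "'a set \<Rightarrow> ('a \<Rightarrow> 'a \<Rightarrow> ennreal) \<Rightarrow> ('a \<Rightarrow> plane set) \<Rightarrow> real \<Rightarrow> real \<Rightarrow> 'a outcome \<Rightarrow> bool"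
  for M \<rho> F l1 l2 where
  no_go_step1:
    "\<lbrakk>\<exists>x\<in>M. refinement M \<rho> F l1 x = {}\<rbrakk>
     \<Longrightarrow> proj_algorithm M \<rho> F l1 l2 No_go"
| no_go_step3:
    "\<lbrakk>\<forall>x\<in>M. refinement M \<rho> F l1 x \<noteq> {};
      \<exists>x\<in>M. refinement M \<rho> (step2_rect M \<rho> F l1) l2 x = {}\<rbrakk>
     \<Longrightarrow> proj_algorithm M \<rho> F l1 l2 No_go"
| success:
    "\<lbrakk>\<forall>x\<in>M. refinement M \<rho> F l1 x \<noteq> {};
      \<forall>x\<in>M. refinement M \<rho> (step2_rect M \<rho> F l1) l2 x \<noteq> {};
      \<forall>x\<in>M. axis_segment_center (Pr (0, 0) (refinement M \<rho> (step2_rect M \<rho> F l1) l2 x)) (g x);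
      \<forall>x\<in>M. Pr (g x) (refinement M \<rho> F l1 x) = {f x}\<rbrakk>
     \<Longrightarrow> proj_algorithm M \<rho> F l1 l2 (Success f)"

end

theory Submission
  imports Defs
begin

text \<open>Write \<open>K(x, z) = F(z) + \<lambda>\<^sub>1 \<rho>(x, z) Q\<^sub>0\<close>.  For a fixed \<open>x\<close>, Helly's theorem shows that the sets
  \<open>K(x, z)\<close> have a common point and that the hull of their intersection \<open>F1(x)\<close> is the
  intersection of the hulls of the pairwise intersections.  Since pairwise intersecting
  rectangles have a common point, Step 3 succeeds, and the rectangles it produces move by at most
  \<open>\<lambda>\<^sub>2 \<rho>(x, y)\<close>; so do the centers \<open>g\<close> of their projections of the origin.

  Let \<open>d(x)\<close> be the distance from \<open>g(x)\<close> to \<open>F1(x)\<close>.  As \<open>g(x)\<close> lies in the hull of \<open>F1(x)\<close>, the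
  projection \<open>f(x)\<close> is a corner of the square \<open>Q(g(x), d(x))\<close>, and the distance is already realized
  by a single \<open>K(x, z)\<close>, which lies in a half-plane touching the square at that corner.  The
  corresponding \<open>K(y, z)\<close> is then in a half-plane shifted by at most \<open>\<lambda>\<^sub>1 \<rho>(x, y)\<close>.  Put
  \<open>D = (\<lambda>\<^sub>1 + \<lambda>\<^sub>2) \<rho>(x, y)\<close>.  If \<open>f(x)\<close> and \<open>f(y)\<close> are equally oriented corners, this gives
  \<open>\<bar>d(x) - d(y)\<bar> \<le> D\<close>; otherwise it gives \<open>d(x) + d(y) \<le> D\<close>.  In both cases \<open>f(x)\<close> and \<open>f(y)\<close> differ
  by at most \<open>\<lambda>\<^sub>2 \<rho>(x, y) + D\<close>.\<close>

subsection \<open>Squares, rectangles and hulls\<close>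

lemma infnorm_plane_le: "infnorm (p :: plane) \<le> r \<longleftrightarrow> \<bar>fst p\<bar> \<le> r \<and> \<bar>snd p\<bar> \<le> r"
  by (simp add: infnorm_plane)

lemma infnorm_plane_less: "infnorm (p :: plane) < r \<longleftrightarrow> \<bar>fst p\<bar> < r \<and> \<bar>snd p\<bar> < r"
  by (simp add: infnorm_plane)

text \<open>Finite and infinite squares are both reduced to one inequality in
  \<open>ennreal\<close>. Radius 0 is treated apart, since otherwise \<open>p\<close> is divided by
  \<open>r\<close>.\<close>

lemma mem_scaled_Q0: "p \<in> scaled_Q0 t \<longleftrightarrow> ennreal (infnorm p) \<le> t"
proof (cases t)
  case (real r)
  have "p \<in> (\<lambda>q. r *\<^sub>R q) ` Q0 \<longleftrightarrow> infnorm p \<le> r"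
  proof
    assume "p \<in> (\<lambda>q. r *\<^sub>R q) ` Q0"
    then obtain q where q: "p = r *\<^sub>R q" "q \<in> Q0"
      by (rule imageE)
    then have "infnorm q \<le> 1"
      by (simp add: Q0_def mem_Times_iff infnorm_plane_le abs_le_iff minus_le_iff)
    then show "infnorm p \<le> r"
      using q(1) real(1) by (simp add: infnorm_mul mult_left_le)
  next
    assume le: "infnorm p \<le> r"
    show "p \<in> (\<lambda>q. r *\<^sub>R q) ` Q0"
    proof (cases "r = 0")
      case True
      then have "p = 0"
        using le infnorm_pos_lt[of p] by linarith
      moreover have "0 \<in> Q0"
        by (simp add: Q0_def mem_Times_iff)
      ultimately show ?thesis
        by (intro image_eqI[of _ _ 0]) simp_all
    next
      case False
      have "infnorm ((1 / r) *\<^sub>R p) \<le> 1"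
        using False real(1) le by (simp add: infnorm_mul divide_le_eq)
      then have "(1 / r) *\<^sub>R p \<in> Q0"
        unfolding infnorm_plane_le Q0_def mem_Times_iff atLeastAtMost_iff by linarith
      then show ?thesis
        using False by (intro image_eqI[of _ _ "(1 / r) *\<^sub>R p"]) simp_all
    qed
  qed
  then show ?thesis
    using real by (simp add: scaled_Q0_def infnorm_pos_le)
qed (simp add: scaled_Q0_def)

lemma mem_plus_scaled_Q0:
  "p \<in> A + scaled_Q0 t \<longleftrightarrow> (\<exists>a\<in>A. ennreal (infnorm (p - a)) \<le> t)"
proof
  assume "p \<in> A + scaled_Q0 t"
  then show "\<exists>a\<in>A. ennreal (infnorm (p - a)) \<le> t"
    by (metis set_plus_elim mem_scaled_Q0 add_diff_cancel_left')
next
  assume "\<exists>a\<in>A. ennreal (infnorm (p - a)) \<le> t"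
  then obtain a where "a \<in> A" "p - a \<in> scaled_Q0 t"
    by (auto simp: mem_scaled_Q0)
  then have "a + (p - a) \<in> A + scaled_Q0 t"
    by (rule set_plus_intro)
  then show "p \<in> A + scaled_Q0 t"
    by simp
qed

lemma subset_plus_scaled_Q0: "A \<subseteq> A + scaled_Q0 t"
proof
  fix p assume "p \<in> A"
  then show "p \<in> A + scaled_Q0 t"
    unfolding mem_plus_scaled_Q0 by (intro bexI[of _ p]) (simp_all add: infnorm_0)
qed

lemma plus_scaled_Q0_zero: "A + scaled_Q0 0 = A"
proof
  show "A + scaled_Q0 0 \<subseteq> A"
  proof
    fix p assume "p \<in> A + scaled_Q0 0"
    then obtain a where "a \<in> A" "infnorm (p - a) \<le> 0"
      by (auto simp: mem_plus_scaled_Q0 ennreal_eq_0_iff)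
    then show "p \<in> A"
      using infnorm_pos_lt[of "p - a"] by simp
  qed
qed (rule subset_plus_scaled_Q0)

lemma plus_scaled_Q0_top: "A \<noteq> {} \<Longrightarrow> A + scaled_Q0 \<infinity> = UNIV"
  using mem_plus_scaled_Q0[of _ A \<infinity>] by auto

lemma scaled_Q0_add: "scaled_Q0 (s + t) \<subseteq> scaled_Q0 s + scaled_Q0 t"
proof
  fix p :: plane
  assume "p \<in> scaled_Q0 (s + t)"
  then have p: "ennreal (infnorm p) \<le> s + t"
    by (simp add: mem_scaled_Q0)
  have "\<exists>a. ennreal (infnorm a) \<le> s \<and> ennreal (infnorm (p - a)) \<le> t"
  proof (cases s)
    case (real u)
    show ?thesis
    proof (cases t)
      case (real v)
      note uv = \<open>s = ennreal u\<close> \<open>t = ennreal v\<close> \<open>0 \<le> u\<close> \<open>0 \<le> v\<close>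
      have le: "infnorm p \<le> u + v"
        using p uv by (simp flip: ennreal_plus)
      show ?thesis
      proof (cases "u + v = 0")
        case True
        then show ?thesis
          using uv le infnorm_pos_le[of p] by (intro exI[of _ 0]) (auto simp: infnorm_0)
      next
        case False
        \<comment> \<open>Cutting \<open>p\<close> in the ratio \<open>u : v\<close> gives pieces of
          norm at most \<open>u\<close> and \<open>v\<close>.\<close>
        define k where "k = u / (u + v)"
        have k: "0 \<le> k" "0 \<le> 1 - k" "k * (u + v) = u" "(1 - k) * (u + v) = v"
          using False uv by (simp_all add: k_def field_simps)
        have "infnorm (k *\<^sub>R p) \<le> u"
          using mult_left_mono[OF le k(1)] k by (simp add: infnorm_mul)
        moreover have "infnorm ((1 - k) *\<^sub>R p) \<le> v"
          using mult_left_mono[OF le k(2)] k by (simp add: infnorm_mul)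
        ultimately show ?thesis
          using uv by (intro exI[of _ "k *\<^sub>R p"]) (auto simp: scaleR_left_diff_distrib)
      qed
    next
      case top
      then show ?thesis
        by (intro exI[of _ 0]) (simp add: infnorm_0)
    qed
  next
    case top
    then show ?thesis
      by (intro exI[of _ p]) (simp add: infnorm_0)
  qed
  then show "p \<in> scaled_Q0 s + scaled_Q0 t"
    unfolding mem_plus_scaled_Q0 by (auto simp: mem_scaled_Q0)
qed

lemma scaled_zero [simp]: "scaled l 0 = 0"
  by (simp add: scaled_def)

lemma scaled_add: "scaled l (r + s) = scaled l r + scaled l s"
  by (auto simp: scaled_def distrib_left)

lemma scaled_mono: "r \<le> s \<Longrightarrow> scaled l r \<le> scaled l s"
  by (auto simp: scaled_def mult_left_mono top_unique)

lemma scaled_ennreal: "0 \<le> l \<Longrightarrow> 0 \<le> t \<Longrightarrow> scaled l (ennreal t) = ennreal (l * t)"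
  by (simp add: scaled_def ennreal_mult)

lemma convex_scaled_Q0: "convex (scaled_Q0 t)"
proof (cases "t = \<infinity>")
  case False
  have "convex Q0"
    unfolding Q0_def by (intro convex_Times convex_real_interval)
  then show ?thesis
    by (simp add: scaled_Q0_def convex_scaling)
qed (simp add: scaled_Q0_def)

lemma closed_plus_scaled_Q0:
  assumes "closed A"
  shows "closed (A + scaled_Q0 t)"
proof (cases "t = \<infinity>")
  case True
  then show ?thesis
    by (cases "A = {}") (auto simp: plus_scaled_Q0_top[unfolded infinity_ennreal_def])
next
  case False
  have "compact Q0"
    unfolding Q0_def by (intro compact_Times compact_Icc)
  then have "compact (scaled_Q0 t)"
    using False by (simp add: scaled_Q0_def compact_scaling)
  then have "closed (\<Union>x\<in>A. \<Union>y\<in>scaled_Q0 t. {x + y})"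
    using assms by (intro closed_compact_sums)
  also have "(\<Union>x\<in>A. \<Union>y\<in>scaled_Q0 t. {x + y}) = A + scaled_Q0 t"
    by (auto simp: set_plus_def)
  finally show ?thesis .
qed

section \<open>Rectangles and rectangular hulls\<close>

lemma is_rectangle_Times:
  assumes "closed I" "is_interval I" "closed J" "is_interval J" "(I :: real set) \<times> (J :: real set) \<noteq> {}"
  shows "is_rectangle (I \<times> J)"
  using assms unfolding is_rectangle_def by blast

lemma rectangle_convex: "is_rectangle R \<Longrightarrow> convex R"
  unfolding is_rectangle_def by (metis convex_Times is_interval_convex)

lemma rectangle_closed: "is_rectangle R \<Longrightarrow> closed R"
  unfolding is_rectangle_def by (auto intro!: closed_Times)

lemma is_rectangle_square:
  assumes "0 \<le> r"
  shows "is_rectangle (square a r)"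
proof -
  have "square a r = {fst a - r .. fst a + r} \<times> {snd a - r .. snd a + r}"
    by (auto simp: square_def infnorm_plane_le abs_le_iff)
  then show ?thesis
    using assms by (auto intro!: is_rectangle_Times simp: is_interval_cc)
qed

lemma rectangle_eq_Times:
  assumes "is_rectangle R"
  shows "R = fst ` R \<times> snd ` R" "closed (fst ` R)" "is_interval (fst ` R)"
    "closed (snd ` R)" "is_interval (snd ` R)"
proof -
  obtain I J where "I \<noteq> {}" "closed I" "is_interval I" "J \<noteq> {}" "closed J" "is_interval J" "R = I \<times> J"
    using assms unfolding is_rectangle_def by blast
  then show "R = fst ` R \<times> snd ` R" "closed (fst ` R)" "is_interval (fst ` R)"
    "closed (snd ` R)" "is_interval (snd ` R)"
    by (simp_all add: fst_image_times snd_image_times)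
qed

text \<open>This coordinate-exchange form passes at once to intersections and to sums with squares.
  The projections are closed because, by exchange, they are sections of \<open>R\<close> along the
  lines through a fixed \<open>a\<close>.\<close>

lemma is_rectangle_iff:
  "is_rectangle R \<longleftrightarrow> R \<noteq> {} \<and> closed R \<and> convex R \<and>
     (\<forall>p\<in>R. \<forall>q\<in>R. (fst p, snd q) \<in> R)"
proof
  assume "is_rectangle R"
  then show "R \<noteq> {} \<and> closed R \<and> convex R \<and> (\<forall>p\<in>R. \<forall>q\<in>R. (fst p, snd q) \<in> R)"
    by (auto simp: rectangle_convex rectangle_closed) (auto simp: is_rectangle_def)
next
  assume R: "R \<noteq> {} \<and> closed R \<and> convex R \<and> (\<forall>p\<in>R. \<forall>q\<in>R. (fst p, snd q) \<in> R)"
  obtain a where a: "a \<in> R"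
    using R by blast
  have eq: "R = fst ` R \<times> snd ` R"
  proof (intro equalityI subsetI)
    fix p assume "p \<in> fst ` R \<times> snd ` R"
    then obtain x y where "x \<in> R" "y \<in> R" "p = (fst x, snd y)"
      by auto
    then show "p \<in> R"
      using R by blast
  qed (auto simp: mem_Times_iff)
  have "fst ` R = (\<lambda>x. (x, snd a)) -` R" "snd ` R = (\<lambda>y. (fst a, y)) -` R"
    using R a by (force simp: image_iff)+
  moreover have "closed ((\<lambda>x. (x, snd a)) -` R)" "closed ((\<lambda>y. (fst a, y)) -` R)"
    using R by (auto intro!: closed_vimage continuous_intros)
  moreover have "convex (fst ` R)" "convex (snd ` R)"
    using R by (auto intro!: convex_linear_image linear_fst linear_snd)
  ultimately have "is_rectangle (fst ` R \<times> snd ` R)"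
    using a by (intro is_rectangle_Times) (auto simp: is_interval_convex_1)
  then show "is_rectangle R"
    using eq by metis
qed

lemma is_rectangle_Inter:
  assumes "\<And>R. R \<in> \<R> \<Longrightarrow> is_rectangle R" "\<Inter>\<R> \<noteq> {}"
  shows "is_rectangle (\<Inter>\<R>)"
  using assms unfolding is_rectangle_iff by (auto intro!: closed_Inter convex_Inter)

lemma is_rectangle_plus_scaled_Q0:
  assumes "is_rectangle R"
  shows "is_rectangle (R + scaled_Q0 t)"
  unfolding is_rectangle_iff
proof (intro conjI ballI)
  show "R + scaled_Q0 t \<noteq> {}"
    using assms subset_plus_scaled_Q0[of R t] unfolding is_rectangle_iff by blast
  show "closed (R + scaled_Q0 t)" "convex (R + scaled_Q0 t)"
    using assms by (auto simp: is_rectangle_iff intro!: closed_plus_scaled_Q0 convex_set_plus convex_scaled_Q0)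
  fix p q assume "p \<in> R + scaled_Q0 t" "q \<in> R + scaled_Q0 t"
  then obtain a b where a: "a \<in> R" "ennreal (infnorm (p - a)) \<le> t"
    and b: "b \<in> R" "ennreal (infnorm (q - b)) \<le> t"
    by (auto simp: mem_plus_scaled_Q0)
  have "infnorm ((fst p, snd q) - (fst a, snd b)) \<le> max (infnorm (p - a)) (infnorm (q - b))"
    unfolding infnorm_plane by (simp; linarith)
  then have "ennreal (infnorm ((fst p, snd q) - (fst a, snd b))) \<le> t"
    using a(2) b(2) by (smt (verit) ennreal_leI max_def order_trans)
  moreover have "(fst a, snd b) \<in> R"
    using assms a b unfolding is_rectangle_iff by blast
  ultimately show "(fst p, snd q) \<in> R + scaled_Q0 t"
    unfolding mem_plus_scaled_Q0 by blast
qed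

text \<open>A rectangle containing \<open>S\<close> has closed sides containing the projections of
  \<open>S\<close>. The closures matter: a closed convex set, such as the region above a branch of a
  hyperbola, may have projections that are not closed.\<close>

lemma rect_hull_convex:
  assumes "convex S"
  shows "rect_hull S = closure (fst ` S) \<times> closure (snd ` S)"
proof (cases "S = {}")
  case False
  have "is_rectangle (closure (fst ` S) \<times> closure (snd ` S))"
    using assms False
    unfolding is_rectangle_iff
    by (auto intro!: closed_Times convex_Times convex_closure convex_linear_image linear_fst linear_snd)
  moreover have "S \<subseteq> closure (fst ` S) \<times> closure (snd ` S)"
    by (intro subsetI, unfold mem_Times_iff, intro conjI closure_subset[THEN subsetD] imageI)
  moreover have "closure (fst ` S) \<times> closure (snd ` S) \<subseteq> R" if R: "is_rectangle R" "S \<subseteq> R" for R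
  proof -
    have "closure (fst ` S) \<subseteq> fst ` R" "closure (snd ` S) \<subseteq> snd ` R"
      by (rule closure_minimal[OF image_mono[OF R(2)]], rule rectangle_eq_Times[OF R(1)])+
    then show ?thesis
      by (subst rectangle_eq_Times(1)[OF R(1)]) (rule Sigma_mono)
  qed
  ultimately have "is_rectangle hull S = closure (fst ` S) \<times> closure (snd ` S)"
    by (intro hull_unique) auto
  then show ?thesis
    using False by (simp add: rect_hull_def)
qed (simp add: rect_hull_def)

lemma rect_hull_mono:
  assumes "convex S" "convex T" "S \<subseteq> T"
  shows "rect_hull S \<subseteq> rect_hull T"
  unfolding rect_hull_convex[OF assms(1)] rect_hull_convex[OF assms(2)]
  by (intro Sigma_mono closure_mono image_mono assms(3))

section \<open>Helly-type theorems on the line, in the plane and for rectangles\<close>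

lemma Helly_real:
  fixes \<C> :: "real set set"
  assumes "finite \<C>" "\<And>C. C \<in> \<C> \<Longrightarrow> convex C" "\<And>A B. A \<in> \<C> \<Longrightarrow> B \<in> \<C> \<Longrightarrow> A \<inter> B \<noteq> {}"
  shows "\<Inter>\<C> \<noteq> {}"
proof (cases "card \<C> \<ge> 2")
  case True
  show ?thesis
  proof (rule Helly)
    fix \<T> assume "\<T> \<subseteq> \<C>" "card \<T> = DIM(real) + 1"
    then obtain A B where "\<T> = {A, B}" "A \<in> \<C>" "B \<in> \<C>"
      using card_2_iff[of \<T>] by auto
    then show "\<Inter>\<T> \<noteq> {}"
      using assms(3) by simp
  qed (use True assms in auto)
next
  case False
  then have "\<C> = {} \<or> (\<exists>A. \<C> = {A})"
    using assms(1) card_1_singleton_iff[of \<C>] by (cases "card \<C>") auto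
  then show ?thesis
    using assms(3) by auto
qed

lemma Helly_plane:
  fixes \<C> :: "plane set set"
  assumes "finite \<C>" "\<And>C. C \<in> \<C> \<Longrightarrow> convex C"
    "\<And>A B C. A \<in> \<C> \<Longrightarrow> B \<in> \<C> \<Longrightarrow> C \<in> \<C> \<Longrightarrow> A \<inter> B \<inter> C \<noteq> {}"
  shows "\<Inter>\<C> \<noteq> {}"
proof (cases "card \<C> \<ge> 3")
  case True
  show ?thesis
  proof (rule Helly)
    fix \<T> assume "\<T> \<subseteq> \<C>" "card \<T> = DIM(plane) + 1"
    then obtain A B C where "\<T> = {A, B, C}" "A \<in> \<C>" "B \<in> \<C>" "C \<in> \<C>"
      using card_3_iff[of \<T>] by auto
    then show "\<Inter>\<T> \<noteq> {}"
      using assms(3)[of A B C] by (simp add: Int_assoc)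
  qed (use True assms in auto)
next
  case False
  then have "\<C> = {} \<or> (\<exists>A B. \<C> = {A, B})"
    using assms(1) card_1_singleton_iff[of \<C>] card_2_iff[of \<C>]
    by (cases "card \<C>" rule: nat.exhaust) (auto simp: numeral_eq_Suc le_Suc_eq less_Suc_eq)
  then show ?thesis
  proof (elim disjE exE)
    fix A B assume "\<C> = {A, B}"
    then show ?thesis
      using assms(3)[of A B B] by (simp add: Int_assoc)
  qed auto
qed

text \<open>Helly's theorem on the line applies in each coordinate separately, and the product
  structure combines the two results.\<close>

lemma Helly_rectangle:
  assumes "finite \<R>" "\<And>R. R \<in> \<R> \<Longrightarrow> is_rectangle R" "\<And>R R'. R \<in> \<R> \<Longrightarrow> R' \<in> \<R> \<Longrightarrow> R \<inter> R' \<noteq> {}"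
  shows "\<Inter>\<R> \<noteq> {}"
proof -
  have ne: "\<Inter>((`) h ` \<R>) \<noteq> {}" if h: "linear h" for h :: "plane \<Rightarrow> real"
  proof (rule Helly_real)
    fix A B assume "A \<in> (`) h ` \<R>" "B \<in> (`) h ` \<R>"
    then obtain R R' where R: "R \<in> \<R>" "R' \<in> \<R>" "A = h ` R" "B = h ` R'"
      by blast
    then obtain p where "p \<in> R" "p \<in> R'"
      using assms(3) by blast
    then show "A \<inter> B \<noteq> {}"
      using R by blast
  qed (use assms h in \<open>auto intro!: convex_linear_image rectangle_convex\<close>)
  obtain x where x: "\<And>R. R \<in> \<R> \<Longrightarrow> x \<in> fst ` R"
    using ne[OF linear_fst] by blast
  obtain y where y: "\<And>R. R \<in> \<R> \<Longrightarrow> y \<in> snd ` R"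
    using ne[OF linear_snd] by blast
  have "(x, y) \<in> R" if "R \<in> \<R>" for R
    using x[OF that] y[OF that] rectangle_eq_Times(1)[OF assms(2)[OF that]] by blast
  then show ?thesis
    by blast
qed

text \<open>The square of radius \<open>t\<close> around \<open>p\<close> is itself a rectangle
  meeting every member, so \<open>Helly_rectangle\<close> finds a point of it common to all
  members.\<close>

lemma Inter_plus_scaled_Q0:
  assumes "finite \<R>" "\<And>R. R \<in> \<R> \<Longrightarrow> is_rectangle R" "\<Inter>\<R> \<noteq> {}"
    and p: "\<And>R. R \<in> \<R> \<Longrightarrow> p \<in> R + scaled_Q0 t"
  shows "p \<in> \<Inter>\<R> + scaled_Q0 t"
proof (cases t)
  case (real r)
  have sq: "square p r \<inter> R \<noteq> {}" if R: "R \<in> \<R>" for R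
  proof -
    obtain a where "a \<in> R" "infnorm (p - a) \<le> r"
      using p[OF R] real by (auto simp: mem_plus_scaled_Q0)
    then show ?thesis
      by (auto simp: square_def infnorm_sub)
  qed
  have "\<Inter>(insert (square p r) \<R>) \<noteq> {}"
  proof (rule Helly_rectangle)
    fix R R' assume "R \<in> insert (square p r) \<R>" "R' \<in> insert (square p r) \<R>"
    moreover have "square p r \<noteq> {}"
      using real is_rectangle_square[of r p] by (simp add: is_rectangle_iff)
    ultimately show "R \<inter> R' \<noteq> {}"
      using sq assms(3) by (auto simp: Int_commute)
  qed (use assms real in \<open>auto intro: is_rectangle_square\<close>)
  then obtain q where "q \<in> \<Inter>\<R>" "infnorm (q - p) \<le> r"
    by (auto simp: square_def)
  then show ?thesis
    unfolding mem_plus_scaled_Q0 using real by (metis ennreal_leI infnorm_sub)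
next
  case top
  then show ?thesis
    using assms(3) by (auto simp: mem_plus_scaled_Q0)
qed

subsection \<open>Intersections of convex sets and their hulls\<close>

text \<open>The vector \<open>v\<close> is a direction of recession: the points
  \<open>(1 - c n) p + c n s n\<close> lie in \<open>C\<close> for large \<open>n\<close> and tend
  to \<open>p + v\<close>.\<close>

lemma closed_convex_recession:
  fixes C :: "'a::real_normed_vector set"
  assumes "closed C" "convex C" "p \<in> C" "\<And>n. s n \<in> C"
    and c: "c \<longlonglongrightarrow> 0" "eventually (\<lambda>n. 0 \<le> c n) sequentially"
    and v: "(\<lambda>n. c n *\<^sub>R s n) \<longlonglongrightarrow> v"
  shows "p + v \<in> C"
proof (rule Lim_in_closed_set[OF \<open>closed C\<close>])
  have "eventually (\<lambda>n. c n < 1) sequentially"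
    using c(1) by (rule order_tendstoD) simp
  with c(2) show "eventually (\<lambda>n. (1 - c n) *\<^sub>R p + c n *\<^sub>R s n \<in> C) sequentially"
    by eventually_elim (use assms in \<open>auto intro!: convexD\<close>)
  have "(\<lambda>n. (1 - c n) *\<^sub>R p + c n *\<^sub>R s n) \<longlonglongrightarrow> (1 - 0) *\<^sub>R p + v"
    by (intro tendsto_intros c v)
  then show "(\<lambda>n. (1 - c n) *\<^sub>R p + c n *\<^sub>R s n) \<longlonglongrightarrow> p + v"
    by simp
qed simp

text \<open>Helly's theorem on the line yields points \<open>(x, Y n)\<close> of each \<open>C \<in> \<C>\<close> with \<open>x\<close> close to
  \<open>q\<close>.  A finite limit point of \<open>Y\<close> gives a common point on the line \<open>x = q\<close>; otherwise all the
  sets recede in one vertical direction, and it is enough that their projections to the first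
  axis have a common point.\<close>

lemma Inter_nonempty_of_common_abscissa:
  fixes \<C> :: "plane set set"
  assumes fin: "finite \<C>" and C: "\<And>C. C \<in> \<C> \<Longrightarrow> convex C" "\<And>C. C \<in> \<C> \<Longrightarrow> closed C"
    and q: "\<And>A B. A \<in> \<C> \<Longrightarrow> B \<in> \<C> \<Longrightarrow> q \<in> closure (fst ` (A \<inter> B))"
  shows "\<Inter>\<C> \<noteq> {}"
proof -
  have strip: "convex {p :: plane. \<bar>fst p - q\<bar> \<le> e}" for e
  proof -
    have "{p :: plane. \<bar>fst p - q\<bar> \<le> e} = fst -` {q - e .. q + e}"
      by auto
    then show ?thesis
      by (simp add: convex_linear_vimage linear_fst)
  qed
  \<comment> \<open>Inside a thin strip around \<open>q\<close> any two of the sets have a common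
    point, by the hypothesis on closures. So the projections of these parts to the second axis meet
    pairwise, and Helly's theorem on the line gives one ordinate for all sets.\<close>
  have "\<exists>y. \<forall>A\<in>\<C>. \<exists>x. \<bar>x - q\<bar> \<le> inverse (real (Suc n)) \<and> (x, y) \<in> A" for n
  proof -
    define S where "S A = snd ` (A \<inter> {p. \<bar>fst p - q\<bar> \<le> inverse (real (Suc n))})" for A :: "plane set"
    have "\<Inter>(S ` \<C>) \<noteq> {}"
    proof (rule Helly_real)
      show "convex K" if "K \<in> S ` \<C>" for K
        using that C(1) unfolding S_def by (auto intro!: convex_linear_image linear_snd convex_Int strip)
      fix K L assume "K \<in> S ` \<C>" "L \<in> S ` \<C>"
      then obtain A B where AB: "A \<in> \<C>" "B \<in> \<C>" "K = S A" "L = S B"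
        by blast
      obtain p where "p \<in> A \<inter> B" "\<bar>fst p - q\<bar> < inverse (real (Suc n))"
        using q[OF AB(1,2)] unfolding closure_approachable dist_real_def
        by (metis imageE inverse_positive_iff_positive of_nat_0_less_iff zero_less_Suc)
      then have "snd p \<in> S A \<inter> S B"
        unfolding S_def by auto
      then show "K \<inter> L \<noteq> {}"
        using AB by blast
    qed (use fin in simp)
    then obtain y where "\<And>A. A \<in> \<C> \<Longrightarrow> y \<in> S A"
      by blast
    then show ?thesis
      unfolding S_def by (intro exI[of _ y]) force
  qed
  then obtain Y where "\<And>n A. A \<in> \<C> \<Longrightarrow> \<exists>x. \<bar>x - q\<bar> \<le> inverse (real (Suc n)) \<and> (x, Y n) \<in> A"
    by metis
  then obtain X where X: "\<And>A n. A \<in> \<C> \<Longrightarrow> \<bar>X A n - q\<bar> \<le> inverse (real (Suc n))"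
    and XY: "\<And>A n. A \<in> \<C> \<Longrightarrow> (X A n, Y n) \<in> A"
    by metis
  have X_lim: "X A \<longlonglongrightarrow> q" if "A \<in> \<C>" for A
  proof (rule Lim_transform)
    show "(\<lambda>n. X A n - q) \<longlonglongrightarrow> 0"
      by (rule Lim_null_comparison[OF _ LIMSEQ_inverse_real_of_nat])
        (use X[OF that] in \<open>simp add: eventually_sequentially\<close>)
  qed simp
  \<comment> \<open>Compactness of the extended reals: a subsequence of \<open>Y\<close> has a
    finite or infinite limit.\<close>
  obtain l r where r: "strict_mono r" and l: "((\<lambda>n. ereal (Y n)) \<circ> r) \<longlonglongrightarrow> l"
    using compact_complete_linorder by blast
  have Xr: "(\<lambda>n. X A (r n)) \<longlonglongrightarrow> q" if "A \<in> \<C>" for A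
    using LIMSEQ_subseq_LIMSEQ[OF X_lim[OF that] r] by (simp add: o_def)
  have vertical: ?thesis if e: "e = 1 \<or> e = - 1" and lim: "filterlim (\<lambda>n. e * Y (r n)) at_top sequentially" for e
  proof -
    have up: "p + (0, e * t) \<in> A" if A: "A \<in> \<C>" "p \<in> A" and t: "0 \<le> t" for A p t
    proof (rule closed_convex_recession)
      \<comment> \<open>This factor makes \<open>c n * Y (r n)\<close> equal to \<open>e * t\<close>
        once \<open>e * Y (r n)\<close> is positive, while \<open>c n * X A (r n)\<close> tends to
        0.\<close>
      define c where "c n = t * inverse (e * Y (r n))" for n
      show c0: "c \<longlonglongrightarrow> 0"
        unfolding c_def
        using tendsto_mult[OF tendsto_const tendsto_inverse_0_at_top[OF lim], of t] by simp
      have pos: "eventually (\<lambda>n. e * Y (r n) > 0) sequentially"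
        using lim by (simp add: filterlim_at_top_dense)
      then show "eventually (\<lambda>n. 0 \<le> c n) sequentially"
        unfolding c_def by eventually_elim (intro mult_nonneg_nonneg t, simp only: inverse_nonnegative_iff_nonnegative less_imp_le)
      have "(\<lambda>n. c n * X A (r n)) \<longlonglongrightarrow> 0 * q"
        by (intro tendsto_intros c0 Xr A)
      moreover have "(\<lambda>n. c n * Y (r n)) \<longlonglongrightarrow> e * t"
      proof (rule tendsto_eventually)
        show "eventually (\<lambda>n. c n * Y (r n) = e * t) sequentially"
          using pos by eventually_elim (use e in \<open>auto simp: c_def field_simps\<close>)
      qed
      ultimately have "(\<lambda>n. (c n * X A (r n), c n * Y (r n))) \<longlonglongrightarrow> (0, e * t)"
        by (intro tendsto_Pair) simp_all
      then show "(\<lambda>n. c n *\<^sub>R (X A (r n), Y (r n))) \<longlonglongrightarrow> (0, e * t)"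
        by simp
      show "(X A (r n), Y (r n)) \<in> A" for n
        by (rule XY[OF A(1)])
    qed (use A C in auto)
    have "\<Inter>((`) fst ` \<C>) \<noteq> {}"
    proof (rule Helly_real)
      fix K L assume "K \<in> (`) fst ` \<C>" "L \<in> (`) fst ` \<C>"
      then obtain A B where AB: "A \<in> \<C>" "B \<in> \<C>" "K = fst ` A" "L = fst ` B"
        by blast
      then have "A \<inter> B \<noteq> {}"
        using q[OF AB(1,2)] by auto
      then show "K \<inter> L \<noteq> {}"
        using AB by blast
    qed (use fin C in \<open>auto intro!: convex_linear_image linear_fst\<close>)
    then obtain x where "\<forall>A\<in>\<C>. x \<in> fst ` A"
      by blast
    then have "\<forall>A\<in>\<C>. \<exists>y. (x, y) \<in> A"
      by force
    then obtain y where y: "\<And>A. A \<in> \<C> \<Longrightarrow> (x, y A) \<in> A"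
      by metis
    \<comment> \<open>The finitely many heights over \<open>x\<close> have a common bound
      \<open>m\<close>; moving vertically inside each set then reaches the same point
      \<open>(x, e * m)\<close>.\<close>
    have "\<exists>m. \<forall>A\<in>\<C>. e * y A \<le> m"
      using bdd_above_finite[OF finite_imageI[OF fin]] by (auto simp: bdd_above_def)
    then obtain m where m: "\<And>A. A \<in> \<C> \<Longrightarrow> e * y A \<le> m"
      by blast
    have "(x, e * m) \<in> A" if "A \<in> \<C>" for A
      using up[OF that y[OF that], of "m - e * y A"] m[OF that] e by (auto simp: algebra_simps)
    then show ?thesis
      by blast
  qed
  show ?thesis
  proof (cases l)
    case (real y)
    then have "(\<lambda>n. Y (r n)) \<longlonglongrightarrow> y"
      using l by (simp add: o_def)
    then have lim: "(\<lambda>n. (X A (r n), Y (r n))) \<longlonglongrightarrow> (q, y)" if "A \<in> \<C>" for A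
      by (intro tendsto_Pair Xr[OF that])
    have "(q, y) \<in> A" if "A \<in> \<C>" for A
      by (rule closed_sequentially[OF C(2)[OF that] _ lim[OF that]]) (rule XY[OF that])
    then show ?thesis
      by blast
  next
    case PInf
    then have "filterlim (\<lambda>n. Y (r n)) at_top sequentially"
      using l by (simp add: o_def tendsto_PInfty_eq_at_top)
    then show ?thesis
      using vertical[of 1] by simp
  next
    case MInf
    then have "((\<lambda>n. - ereal (Y (r n))) \<longlongrightarrow> \<infinity>) sequentially"
      using l[unfolded ereal_Lim_uminus[of _ l]] by (simp add: o_def)
    then have "filterlim (\<lambda>n. - Y (r n)) at_top sequentially"
      by (simp add: tendsto_PInfty_eq_at_top)
    then show ?thesis
      using vertical[of "- 1"] by simp
  qed
qed

text \<open>Helly's theorem in the plane is applied to the family enlarged by the strip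
  \<open>S\<close> where \<open>h\<close> is within \<open>e\<close> of \<open>q\<close>. Triples
  with the strip meet because of \<open>q\<close>, the others because of \<open>ne\<close>.\<close>

lemma closure_linear_image_Inter:
  fixes \<C> :: "plane set set" and h :: "plane \<Rightarrow> real"
  assumes fin: "finite \<C>" "\<C> \<noteq> {}" and C: "\<And>C. C \<in> \<C> \<Longrightarrow> convex C" and ne: "\<Inter>\<C> \<noteq> {}"
    and h: "linear h"
    and q: "\<And>A B. A \<in> \<C> \<Longrightarrow> B \<in> \<C> \<Longrightarrow> q \<in> closure (h ` (A \<inter> B))"
  shows "q \<in> closure (h ` \<Inter>\<C>)"
  unfolding closure_approachable_le
proof (intro allI impI)
  fix e :: real
  assume e: "0 < e"
  define S where "S = {p. dist (h p) q \<le> e}"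
  have "S = h -` {q - e .. q + e}"
    by (auto simp: S_def dist_real_def)
  then have S: "convex S"
    using h by (simp add: convex_linear_vimage)
  have SAB: "S \<inter> (A \<inter> B) \<noteq> {}" if "A \<in> \<C>" "B \<in> \<C>" for A B
    using q[OF that] e unfolding closure_approachable_le S_def by blast
  obtain A\<^sub>0 where A\<^sub>0: "A\<^sub>0 \<in> \<C>"
    using fin by blast
  have "\<Inter>(insert S \<C>) \<noteq> {}"
  proof (rule Helly_plane)
    fix A B C assume "A \<in> insert S \<C>" "B \<in> insert S \<C>" "C \<in> insert S \<C>"
    then show "A \<inter> B \<inter> C \<noteq> {}"
      using SAB[of A B] SAB[of A C] SAB[of B C] SAB[of A A] SAB[of B B] SAB[of C C]
        SAB[OF A\<^sub>0 A\<^sub>0] ne by blast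
  qed (use S C fin in auto)
  then show "\<exists>y\<in>h ` \<Inter>\<C>. dist y q \<le> e"
    unfolding S_def by blast
qed

text \<open>The pairwise hulls have a common point \<open>q\<close> by
  \<open>Helly_rectangle\<close>, and its abscissa is what
  \<open>Inter_nonempty_of_common_abscissa\<close> asks for. Once a common point exists,
  \<open>closure_linear_image_Inter\<close> identifies the hull coordinate by coordinate.\<close>

lemma rect_hull_Inter:
  fixes \<C> :: "plane set set"
  assumes fin: "finite \<C>" "\<C> \<noteq> {}"
    and C: "\<And>C. C \<in> \<C> \<Longrightarrow> convex C" "\<And>C. C \<in> \<C> \<Longrightarrow> closed C"
    and meet: "\<And>A B A' B'. A \<in> \<C> \<Longrightarrow> B \<in> \<C> \<Longrightarrow> A' \<in> \<C> \<Longrightarrow> B' \<in> \<C> \<Longrightarrow>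
      rect_hull (A \<inter> B) \<inter> rect_hull (A' \<inter> B') \<noteq> {}"
  shows "\<Inter>\<C> \<noteq> {}"
    and "rect_hull (\<Inter>\<C>) = (\<Inter>A\<in>\<C>. \<Inter>B\<in>\<C>. rect_hull (A \<inter> B))"
proof -
  define \<R> where "\<R> = (\<lambda>(A, B). rect_hull (A \<inter> B)) ` (\<C> \<times> \<C>)"
  have hull: "rect_hull (A \<inter> B) = closure (fst ` (A \<inter> B)) \<times> closure (snd ` (A \<inter> B))"
    if "A \<in> \<C>" "B \<in> \<C>" for A B
    using that C by (intro rect_hull_convex convex_Int)
  have "\<Inter>\<R> \<noteq> {}"
  proof (rule Helly_rectangle)
    show "finite \<R>"
      using fin by (simp add: \<R>_def)
    show "is_rectangle R" if R: "R \<in> \<R>" for R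
    proof -
      obtain A B where "A \<in> \<C>" "B \<in> \<C>" "R = rect_hull (A \<inter> B)"
        using R by (auto simp: \<R>_def)
      then show ?thesis
        using meet[of A B A B] is_rectangle_rect_hull(1)[of "A \<inter> B"] by (auto simp: rect_hull_def)
    qed
    show "R \<inter> R' \<noteq> {}" if "R \<in> \<R>" "R' \<in> \<R>" for R R'
      using that meet by (auto simp: \<R>_def)
  qed
  then obtain q where "q \<in> rect_hull (A \<inter> B)" if "A \<in> \<C>" "B \<in> \<C>" for A B
    by (force simp: \<R>_def)
  then have "fst q \<in> closure (fst ` (A \<inter> B))" if "A \<in> \<C>" "B \<in> \<C>" for A B
    using that hull by (auto simp: mem_Times_iff)
  then show ne: "\<Inter>\<C> \<noteq> {}"
    using fin(1) C by (intro Inter_nonempty_of_common_abscissa)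
  show "rect_hull (\<Inter>\<C>) = (\<Inter>A\<in>\<C>. \<Inter>B\<in>\<C>. rect_hull (A \<inter> B))"
  proof (intro equalityI subsetI)
    fix p assume "p \<in> rect_hull (\<Inter>\<C>)"
    moreover have "rect_hull (\<Inter>\<C>) \<subseteq> rect_hull (A \<inter> B)" if "A \<in> \<C>" "B \<in> \<C>" for A B
      using that C by (intro rect_hull_mono convex_Inter convex_Int) auto
    ultimately show "p \<in> (\<Inter>A\<in>\<C>. \<Inter>B\<in>\<C>. rect_hull (A \<inter> B))"
      by blast
  next
    fix p assume "p \<in> (\<Inter>A\<in>\<C>. \<Inter>B\<in>\<C>. rect_hull (A \<inter> B))"
    then have p: "fst p \<in> closure (fst ` (A \<inter> B))" "snd p \<in> closure (snd ` (A \<inter> B))"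
      if "A \<in> \<C>" "B \<in> \<C>" for A B
      using that hull by (auto simp: mem_Times_iff)
    have "fst p \<in> closure (fst ` \<Inter>\<C>)" "snd p \<in> closure (snd ` \<Inter>\<C>)"
      using fin C(1) ne p by (auto intro!: closure_linear_image_Inter linear_fst linear_snd)
    then show "p \<in> rect_hull (\<Inter>\<C>)"
      using C(1) by (simp add: rect_hull_convex convex_Inter mem_Times_iff)
  qed
qed

subsection \<open>Projection onto an intersection\<close>

lemma rect_hull_approx:
  assumes "convex S" "g \<in> rect_hull S" "0 < e"
  shows "\<exists>p\<in>S. \<bar>fst p - fst g\<bar> < e" "\<exists>p\<in>S. \<bar>snd p - snd g\<bar> < e"
proof -
  have "fst g \<in> closure (fst ` S)" "snd g \<in> closure (snd ` S)"
    using assms(2) by (simp_all add: rect_hull_convex[OF assms(1)] mem_Times_iff)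
  then show "\<exists>p\<in>S. \<bar>fst p - fst g\<bar> < e" "\<exists>p\<in>S. \<bar>snd p - snd g\<bar> < e"
    using assms(3) unfolding closure_approachable dist_real_def by blast+
qed

lemma unif_dist_le: "s \<in> S \<Longrightarrow> unif_dist a S \<le> infnorm (a - s)"
  unfolding unif_dist_def by (rule cINF_lower) (auto intro!: bdd_belowI[of _ 0] simp: infnorm_pos_le)

lemma unif_dist_attained:
  assumes "closed S" "S \<noteq> {}"
  obtains s where "s \<in> S" "infnorm (a - s) = unif_dist a S"
proof -
  obtain z where z: "z \<in> S"
    using assms(2) by blast
  define r where "r = infnorm (a - z)"
  have "compact (S \<inter> square a r)"
  proof -
    have "square a r = {fst a - r .. fst a + r} \<times> {snd a - r .. snd a + r}"
      by (auto simp: square_def infnorm_plane_le abs_le_iff)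
    then have "compact (square a r)"
      by (simp add: compact_Times)
    then show ?thesis
      using assms(1) by (rule closed_Int_compact[rotated])
  qed
  moreover have "z \<in> S \<inter> square a r"
    using z by (simp add: r_def square_def infnorm_sub)
  moreover have cont: "continuous_on (S \<inter> square a r) (\<lambda>y. infnorm (a - y))"
    by (intro continuous_intros)
  ultimately obtain s where s: "s \<in> S \<inter> square a r"
    "\<And>y. y \<in> S \<inter> square a r \<Longrightarrow> infnorm (a - s) \<le> infnorm (a - y)"
    using continuous_attains_inf[of "S \<inter> square a r" "\<lambda>y. infnorm (a - y)", OF _ _ cont] by blast
  have "infnorm (a - s) \<le> infnorm (a - y)" if "y \<in> S" for y
  proof (cases "y \<in> square a r")
    case False
    then show ?thesis
      using s(1) by (simp add: square_def infnorm_sub)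
  qed (use s that in auto)
  then have "infnorm (a - s) \<le> unif_dist a S"
    unfolding unif_dist_def using assms(2) by (intro cINF_greatest)
  then show thesis
    using that[of s] unif_dist_le[of s S a] s(1) by simp
qed

lemma unif_dist_nonneg: "S \<noteq> {} \<Longrightarrow> 0 \<le> unif_dist a S"
  unfolding unif_dist_def by (intro cINF_greatest) (auto simp: infnorm_pos_le)

lemma mem_Pr: "p \<in> Pr a S \<longleftrightarrow> p \<in> S \<and> infnorm (p - a) \<le> unif_dist a S"
  by (simp add: Pr_def square_def)

lemma convex_infnorm_ball: "convex {p. infnorm (p - a) < (d :: real)}" for a :: plane
proof -
  have "{p. infnorm (p - a) < d} = {fst a - d <..< fst a + d} \<times> {snd a - d <..< snd a + d}"
    by (auto simp: infnorm_plane_less abs_less_iff)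
  then show ?thesis
    by (simp add: convex_Times)
qed

text \<open>A line separates the open square of radius \<open>d\<close> around \<open>g\<close> from
  \<open>C\<close>; its normal is scaled to norm 1 in the norm dual to the uniform one. A zero
  coefficient would make the line vertical or horizontal and at distance at least \<open>d\<close>
  from \<open>g\<close>, which \<open>rect_hull_approx\<close> excludes.\<close>

lemma separating_functional:
  assumes C: "convex C" and g: "g \<in> rect_hull C" and d: "0 < d"
    and far: "\<And>p. p \<in> C \<Longrightarrow> d \<le> infnorm (p - g)"
  obtains a b where "a \<noteq> 0" "b \<noteq> 0" "\<bar>a\<bar> + \<bar>b\<bar> = 1"
    "\<And>p. p \<in> C \<Longrightarrow> d \<le> a * (fst p - fst g) + b * (snd p - snd g)"
proof -
  define U where "U = {p. infnorm (p - g) < d}"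
  have "convex U"
    unfolding U_def by (rule convex_infnorm_ball)
  moreover have "g \<in> U"
    using d by (simp add: U_def infnorm_0)
  moreover have "C \<noteq> {}"
    using g by (auto simp: rect_hull_def)
  moreover have "U \<inter> C = {}"
    using far by (force simp: U_def)
  ultimately obtain v c where v: "v \<noteq> 0" and U: "\<And>p. p \<in> U \<Longrightarrow> v \<bullet> p \<le> c"
    and Cc: "\<And>p. p \<in> C \<Longrightarrow> c \<le> v \<bullet> p"
    using separating_hyperplane_sets[of U C] C by blast
  define N where "N = \<bar>fst v\<bar> + \<bar>snd v\<bar>"
  have N: "0 < N"
    using v by (auto simp: N_def prod_eq_iff)
  have "(d - e) * N \<le> c - v \<bullet> g" if e: "0 < e" "e < d" for e
  proof -
    \<comment> \<open>This point maximizes \<open>v\<close> over the square of radius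
      \<open>d - e\<close>; the slack \<open>e\<close> keeps it inside the open square
      \<open>U\<close>.\<close>
    define p where "p = g + ((d - e) * sgn (fst v), (d - e) * sgn (snd v))"
    have "p \<in> U"
      using e by (auto simp: U_def p_def infnorm_plane_less abs_mult sgn_real_def)
    then have "v \<bullet> p \<le> c"
      by (rule U)
    moreover have "v \<bullet> p = v \<bullet> g + (d - e) * N"
      by (simp add: p_def N_def inner_prod_def algebra_simps abs_sgn)
    ultimately show ?thesis
      by simp
  qed
  note near = this
  have key: "d * N \<le> c - v \<bullet> g"
  proof (rule field_le_epsilon)
    fix e :: real assume e: "0 < e"
    define e' where "e' = min (d / 2) (e / N)"
    have "0 < e'" "e' < d" "e' * N \<le> e"
      using e d N by (simp_all add: e'_def min_def field_simps)
    then show "d * N \<le> c - v \<bullet> g + e"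
      using near[of e'] by (simp add: algebra_simps)
  qed
  define a b where "a = fst v / N" and "b = snd v / N"
  have ab: "\<bar>a\<bar> + \<bar>b\<bar> = 1"
    using N by (simp add: a_def b_def N_def flip: add_divide_distrib)
  have C_le: "d \<le> a * (fst p - fst g) + b * (snd p - snd g)" if "p \<in> C" for p
  proof -
    have "d * N \<le> v \<bullet> (p - g)"
      using key Cc[OF that] by (simp add: inner_diff_right)
    also have "\<dots> = (a * (fst p - fst g) + b * (snd p - snd g)) * N"
      using N by (simp add: a_def b_def inner_prod_def field_simps)
    finally show ?thesis
      using N by simp
  qed
  have "b \<noteq> 0"
  proof
    assume "b = 0"
    obtain p where "p \<in> C" "\<bar>fst p - fst g\<bar> < d"
      using rect_hull_approx(1)[OF C g d] by blast
    moreover have "\<bar>a * (fst p - fst g)\<bar> = \<bar>fst p - fst g\<bar>"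
      using ab \<open>b = 0\<close> by (simp add: abs_mult)
    ultimately show False
      using C_le[of p] \<open>b = 0\<close> by simp
  qed
  moreover have "a \<noteq> 0"
  proof
    assume "a = 0"
    obtain p where "p \<in> C" "\<bar>snd p - snd g\<bar> < d"
      using rect_hull_approx(2)[OF C g d] by blast
    moreover have "\<bar>b * (snd p - snd g)\<bar> = \<bar>snd p - snd g\<bar>"
      using ab \<open>a = 0\<close> by (simp add: abs_mult)
    ultimately show False
      using C_le[of p] \<open>a = 0\<close> by simp
  qed
  ultimately show thesis
    using that ab C_le by blast
qed

text \<open>By Cramer's rule the determinants \<open>u\<close>, \<open>v\<close>, \<open>w\<close>
  satisfy \<open>u p + v q + w r = 0\<close>. The sign conditions make them nonnegative and
  \<open>w\<close> positive, so after division by their sum they are barycentric coordinates of the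
  origin.\<close>

lemma zero_in_convex_triangle:
  fixes p1 p2 q1 q2 r1 r2 :: real
  assumes C: "convex C" "(p1, p2) \<in> C" "(q1, q2) \<in> C" "(r1, r2) \<in> C"
    and p: "p1 < 0" "0 < p2" and q: "0 < q1" "q2 < 0" and r: "r1 \<le> 0" "r2 \<le> 0"
    and above: "p1 * q2 < p2 * q1"
  shows "(0, 0) \<in> C"
proof -
  define u v w where "u = r1 * q2 - r2 * q1" and "v = r2 * p1 - r1 * p2" and "w = p2 * q1 - p1 * q2"
  have uvw: "0 \<le> u" "0 \<le> v" "0 < w"
    using mult_nonpos_nonpos[of r1 q2] mult_nonpos_nonneg[of r2 q1] mult_nonpos_nonpos[of r2 p1]
      mult_nonpos_nonneg[of r1 p2] p q r above
    by (simp_all add: u_def v_def w_def)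
  define s where "s = u + v + w"
  have s: "0 < s"
    using uvw by (simp add: s_def)
  have "(u / s) *\<^sub>R (p1, p2) + (v / s) *\<^sub>R (q1, q2) + (w / s) *\<^sub>R (r1, r2) \<in> C"
  proof -
    have sum1: "u / s + v / s + w / s = 1"
      using s by (simp add: s_def flip: add_divide_distrib)
    have nonneg: "0 \<le> u / s" "0 \<le> v / s" "0 \<le> w / s"
      using uvw s by simp_all
    have "convex hull {(p1, p2), (q1, q2), (r1, r2)} \<subseteq> C"
      using C by (intro hull_minimal) auto
    then show ?thesis
      unfolding convex_hull_3 using sum1 nonneg by blast
  qed
  moreover have "u * p1 + v * q1 + w * r1 = 0" "u * p2 + v * q2 + w * r2 = 0"
    by (simp_all add: u_def v_def w_def algebra_simps)
  ultimately show ?thesis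
    using s by (simp add: add_divide_distrib[symmetric])
qed

text \<open>Seen from a corner of the square \<open>Q(g, r)\<close>, the set \<open>S\<close> has a point to the upper left and one
  to the lower right, because \<open>g\<close> lies in its hull, and \<open>z\<close> is on the lower left: the corner lies in
  the triangle spanned by the three.\<close>

lemma corner_mem:
  assumes C: "convex C" "S \<subseteq> C" and S: "convex S" "g \<in> rect_hull S"
    and ab: "a \<noteq> 0" "b \<noteq> 0" "\<bar>a\<bar> + \<bar>b\<bar> = (1 :: real)"
    and far: "\<And>p. p \<in> S \<Longrightarrow> d \<le> a * (fst p - fst g) + b * (snd p - snd g)"
    and r: "0 < r" "r < d" and z: "z \<in> C" "infnorm (z - g) \<le> r"
  shows "g + (r * sgn a, r * sgn b) \<in> C"
proof -
  \<comment> \<open>Reflections by the signs of \<open>a\<close> and \<open>b\<close> and a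
    translation move the corner to the origin and the square into the lower left quadrant.\<close>
  define T where "T p = (sgn a * (fst p - fst g) - r, sgn b * (snd p - snd g) - r)" for p :: plane
  have "T ` C = (+) (T 0) ` (\<lambda>p. (sgn a * fst p, sgn b * snd p)) ` C"
    by (simp add: T_def image_image algebra_simps)
  moreover have "linear (\<lambda>p :: plane. (sgn a * fst p, sgn b * snd p))"
    by (rule linearI) (simp_all add: algebra_simps)
  ultimately have TC: "convex (T ` C)"
    using C(1) by (simp add: convex_linear_image)
  \<comment> \<open>Since \<open>r < d\<close>, the half-plane containing \<open>S\<close> leaves
    the corner strictly outside.\<close>
  have T_pos: "0 < \<bar>a\<bar> * fst (T p) + \<bar>b\<bar> * snd (T p)" if "p \<in> S" for p
  proof -
    have "\<bar>a\<bar> * fst (T p) + \<bar>b\<bar> * snd (T p) =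
        (\<bar>a\<bar> * sgn a) * (fst p - fst g) + (\<bar>b\<bar> * sgn b) * (snd p - snd g) - (\<bar>a\<bar> + \<bar>b\<bar>) * r"
      by (simp add: T_def algebra_simps)
    also have "\<dots> = a * (fst p - fst g) + b * (snd p - snd g) - r"
      using ab(3) by (simp add: mult.commute[of "\<bar>_\<bar>"] sgn_mult_abs)
    finally show ?thesis
      using far[OF that] r by simp
  qed
  have sgn_le: "sgn c * x \<le> \<bar>x\<bar>" for c x :: real
    by (auto simp: sgn_real_def)
  obtain p where p: "p \<in> S" "\<bar>fst p - fst g\<bar> < r"
    using rect_hull_approx(1)[OF S r(1)] by blast
  have p1: "fst (T p) < 0"
    using p(2) sgn_le[of a "fst p - fst g"] by (simp add: T_def)
  then have "\<bar>a\<bar> * fst (T p) < 0"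
    using ab by (simp add: mult_less_0_iff)
  then have p2: "0 < snd (T p)"
    using T_pos[OF p(1)] ab by (smt (verit) zero_less_mult_pos zero_less_abs_iff)
  obtain q where q: "q \<in> S" "\<bar>snd q - snd g\<bar> < r"
    using rect_hull_approx(2)[OF S r(1)] by blast
  have q2: "snd (T q) < 0"
    using q(2) sgn_le[of b "snd q - snd g"] by (simp add: T_def)
  then have "\<bar>b\<bar> * snd (T q) < 0"
    using ab by (simp add: mult_less_0_iff)
  then have q1: "0 < fst (T q)"
    using T_pos[OF q(1)] ab by (smt (verit) zero_less_mult_pos zero_less_abs_iff)
  have z12: "fst (T z) \<le> 0" "snd (T z) \<le> 0"
    using z(2) sgn_le[of a "fst z - fst g"] sgn_le[of b "snd z - snd g"]
    by (auto simp: T_def infnorm_plane_le)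
  \<comment> \<open>Multiplying the half-plane inequalities of the two points and cancelling
    \<open>\<bar>a\<bar> * \<bar>b\<bar>\<close> shows that the origin is strictly below the line
    through their images.\<close>
  have above: "fst (T p) * snd (T q) < snd (T p) * fst (T q)"
  proof -
    have "\<bar>a\<bar> * - fst (T p) < \<bar>b\<bar> * snd (T p)" "\<bar>b\<bar> * - snd (T q) < \<bar>a\<bar> * fst (T q)"
      using T_pos[OF p(1)] T_pos[OF q(1)] by simp_all
    then have "(\<bar>a\<bar> * - fst (T p)) * (\<bar>b\<bar> * - snd (T q)) < (\<bar>b\<bar> * snd (T p)) * (\<bar>a\<bar> * fst (T q))"
      by (rule mult_strict_mono)
        (use p1 p2 q1 q2 ab in \<open>simp_all add: mult_nonneg_nonpos less_imp_le\<close>)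
    then have "(\<bar>a\<bar> * \<bar>b\<bar>) * (fst (T p) * snd (T q)) < (\<bar>a\<bar> * \<bar>b\<bar>) * (snd (T p) * fst (T q))"
      by (simp add: algebra_simps)
    then show ?thesis
      using ab by (simp add: mult_less_cancel_left_pos)
  qed
  have "(fst (T x), snd (T x)) \<in> T ` C" if "x \<in> C" for x
    using that by simp
  then have "(0, 0) \<in> T ` C"
    using TC C(2) p(1) q(1) z(1) p1 p2 q1 q2 z12 above
    by (intro zero_in_convex_triangle[of "T ` C" "fst (T p)" "snd (T p)" "fst (T q)" "snd (T q)"
          "fst (T z)" "snd (T z)"]) blast+
  then obtain c where c: "c \<in> C" "sgn a * (fst c - fst g) = r" "sgn b * (snd c - snd g) = r"
    by (auto simp: T_def)
  have "x = r * sgn s" if "sgn s * x = r" "s \<noteq> 0" for x s :: real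
    using that by (auto simp: sgn_real_def split: if_splits)
  then have "fst c - fst g = r * sgn a" "snd c - snd g = r * sgn b"
    using c ab by blast+
  then have "c = g + (r * sgn a, r * sgn b)"
    by (simp add: prod_eq_iff)
  then show ?thesis
    using c(1) by simp
qed

lemma infnorm_corner: "0 \<le> r \<Longrightarrow> infnorm ((r * sgn a, r * sgn b) :: plane) \<le> r"
  by (simp add: infnorm_plane abs_mult sgn_real_def)

text \<open>If every member came closer to \<open>g\<close> than the intersection does,
  \<open>corner_mem\<close> would put one corner of a smaller square into all of them. So some
  member is as far from \<open>g\<close> as the intersection; its separating half-plane meets the
  square in a single corner, both coefficients being nonzero.\<close>

lemma Pr_Inter:
  assumes fin: "finite \<C>" and C: "\<And>C. C \<in> \<C> \<Longrightarrow> convex C" "\<And>C. C \<in> \<C> \<Longrightarrow> closed C"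
    and g: "g \<in> rect_hull (\<Inter>\<C>)" and d: "0 < unif_dist g (\<Inter>\<C>)"
  obtains C a b where "C \<in> \<C>" "a \<noteq> 0" "b \<noteq> 0" "\<bar>a\<bar> + \<bar>b\<bar> = 1"
    "\<And>p. p \<in> C \<Longrightarrow> unif_dist g (\<Inter>\<C>) \<le> a * (fst p - fst g) + b * (snd p - snd g)"
    "Pr g (\<Inter>\<C>) = {g + (unif_dist g (\<Inter>\<C>) * sgn a, unif_dist g (\<Inter>\<C>) * sgn b)}"
proof -
  define S d where "S = \<Inter>\<C>" and "d = unif_dist g (\<Inter>\<C>)"
  note d = d[folded d_def]
  have S: "convex S" "closed S" "g \<in> rect_hull S"
    using C g by (auto simp: S_def intro: convex_Inter)
  then have S_ne: "S \<noteq> {}"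
    by (auto simp: rect_hull_def)
  have S_far: "d \<le> infnorm (p - g)" if "p \<in> S" for p
    using unif_dist_le[of p S g] that by (simp add: S_def d_def infnorm_sub)
  have "\<exists>C\<in>\<C>. \<forall>p\<in>C. d \<le> infnorm (p - g)"
  proof (rule ccontr)
    assume "\<not> ?thesis"
    then have "\<forall>C\<in>\<C>. \<exists>p\<in>C. infnorm (p - g) < d"
      by (simp add: not_le)
    then obtain z where z: "\<And>C. C \<in> \<C> \<Longrightarrow> z C \<in> C" "\<And>C. C \<in> \<C> \<Longrightarrow> infnorm (z C - g) < d"
      by metis
    \<comment> \<open>The entry \<open>d / 2\<close> keeps \<open>r\<close> positive even if every
      \<open>z C\<close> equals \<open>g\<close>.\<close>
    define r where "r = Max (insert (d / 2) ((\<lambda>C. infnorm (z C - g)) ` \<C>))"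
    have "r < d"
      using fin z(2) d by (simp add: r_def)
    moreover have "d / 2 \<le> r"
      unfolding r_def using fin by (intro Max_ge) auto
    ultimately have r: "0 < r" "r < d"
      using d by linarith+
    have zr: "infnorm (z C - g) \<le> r" if "C \<in> \<C>" for C
      unfolding r_def using fin that by (intro Max_ge) auto
    \<comment> \<open>Separating the intersection \<open>S\<close> itself yields the same corner for
      all members.\<close>
    obtain a b where ab: "a \<noteq> 0" "b \<noteq> 0" "\<bar>a\<bar> + \<bar>b\<bar> = 1"
      and far: "\<And>p. p \<in> S \<Longrightarrow> d \<le> a * (fst p - fst g) + b * (snd p - snd g)"
      using separating_functional[OF S(1,3) d S_far] by blast
    have "g + (r * sgn a, r * sgn b) \<in> C" if "C \<in> \<C>" for C
      by (rule corner_mem[OF C(1)[OF that] _ S(1,3) ab far r z(1)[OF that] zr[OF that]])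
        (use that in \<open>auto simp: S_def\<close>)
    then have "g + (r * sgn a, r * sgn b) \<in> S"
      by (simp add: S_def)
    then show False
      using S_far[of "g + (r * sgn a, r * sgn b)"] infnorm_corner[of r a b] r by simp
  qed
  then obtain C\<^sub>0 where C\<^sub>0: "C\<^sub>0 \<in> \<C>" "\<And>p. p \<in> C\<^sub>0 \<Longrightarrow> d \<le> infnorm (p - g)"
    by blast
  have "S \<subseteq> C\<^sub>0"
    using C\<^sub>0(1) by (auto simp: S_def)
  then have "g \<in> rect_hull C\<^sub>0"
    using rect_hull_mono[OF S(1) C(1)[OF C\<^sub>0(1)]] S(3) by blast
  then obtain a b where ab: "a \<noteq> 0" "b \<noteq> 0" "\<bar>a\<bar> + \<bar>b\<bar> = 1"
    and far: "\<And>p. p \<in> C\<^sub>0 \<Longrightarrow> d \<le> a * (fst p - fst g) + b * (snd p - snd g)"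
    using separating_functional[OF C(1)[OF C\<^sub>0(1)] _ d C\<^sub>0(2)] by blast
  have unique: "p = g + (d * sgn a, d * sgn b)" if p: "p \<in> Pr g S" for p
  proof -
    have "infnorm (p - g) \<le> d" "p \<in> S"
      using p by (simp_all add: mem_Pr S_def d_def)
    then have le: "\<bar>fst p - fst g\<bar> \<le> d" "\<bar>snd p - snd g\<bar> \<le> d"
      and ge: "d \<le> a * (fst p - fst g) + b * (snd p - snd g)"
      using far \<open>S \<subseteq> C\<^sub>0\<close> by (auto simp: infnorm_plane_le)
    have "a * (fst p - fst g) \<le> \<bar>a\<bar> * d" "b * (snd p - snd g) \<le> \<bar>b\<bar> * d"
      using mult_left_mono[OF le(1), of "\<bar>a\<bar>"] mult_left_mono[OF le(2), of "\<bar>b\<bar>"]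
        abs_ge_self[of "a * (fst p - fst g)"] abs_ge_self[of "b * (snd p - snd g)"]
      by (simp_all add: abs_mult)
    moreover have "\<bar>a\<bar> * d + \<bar>b\<bar> * d = d"
      using ab(3) by (simp flip: distrib_right)
    \<comment> \<open>The upper bounds of the two summands add up to \<open>d\<close>, so both are
      attained.\<close>
    ultimately have "a * (fst p - fst g) = \<bar>a\<bar> * d" "b * (snd p - snd g) = \<bar>b\<bar> * d"
      using ge by linarith+
    moreover have "x = d * sgn s" if "s * x = \<bar>s\<bar> * d" "s \<noteq> 0" for x s :: real
    proof -
      have "s * x = s * (d * sgn s)"
        using that(1) by (simp add: abs_sgn algebra_simps)
      then show ?thesis
        using that(2) by simp
    qed
    ultimately have "fst p - fst g = d * sgn a" "snd p - snd g = d * sgn b"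
      using ab by blast+
    then show ?thesis
      by (simp add: prod_eq_iff)
  qed
  obtain s where "s \<in> S" "infnorm (g - s) = unif_dist g S"
    using unif_dist_attained[OF S(2) S_ne] by blast
  then have "s \<in> Pr g S"
    by (simp add: mem_Pr infnorm_sub)
  then have "Pr g S = {g + (d * sgn a, d * sgn b)}"
    using unique by blast
  then show thesis
    using that[OF C\<^sub>0(1) ab] far by (simp add: S_def d_def)
qed

lemma Pr_singleton:
  assumes C: "convex S" "closed S" and g: "g \<in> rect_hull S"
  obtains f where "Pr g S = {f}"
proof (cases "0 < unif_dist g S")
  case True
  have S: "finite {S}" "\<And>C. C \<in> {S} \<Longrightarrow> convex C" "\<And>C. C \<in> {S} \<Longrightarrow> closed C"
    "g \<in> rect_hull (\<Inter>{S})" "0 < unif_dist g (\<Inter>{S})"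
    using assms True by simp_all
  show thesis
    by (rule Pr_Inter[OF S]) (simp_all only: Inter_insert Inter_empty Int_UNIV_right that)
next
  case False
  have "S \<noteq> {}"
    using g by (auto simp: rect_hull_def)
  then obtain s where s: "s \<in> S" "infnorm (g - s) = unif_dist g S"
    using unif_dist_attained[OF C(2)] by blast
  have 0: "unif_dist g S = 0"
    using unif_dist_nonneg[OF \<open>S \<noteq> {}\<close>, of g] False by linarith
  then have "s = g"
    using s(2) by (simp add: infnorm_eq_0)
  moreover have "p = g" if "p \<in> Pr g S" for p
    using that 0 infnorm_pos_lt[of "p - g"] by (simp add: mem_Pr)
  ultimately have "Pr g S = {g}"
    using s(1) 0 by (auto simp: mem_Pr infnorm_0)
  then show thesis
    by (rule that)
qed

section \<open>Distance between two projections\<close>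

lemma opposite_sign_bound:
  fixes a a' b b' c c' :: real
  assumes opp: "a * a' < 0"
    and ex: "\<And>e. 0 < e \<Longrightarrow> \<exists>u v. \<bar>v\<bar> < e \<and> c \<le> a * u + b * v \<and> c' \<le> a' * u + b' * v"
  shows "\<bar>a\<bar> * c' + \<bar>a'\<bar> * c \<le> 0"
proof (rule field_le_epsilon)
  fix e :: real assume e: "0 < e"
  define K where "K = \<bar>\<bar>a\<bar> * b' + \<bar>a'\<bar> * b\<bar>"
  have K: "0 \<le> K"
    by (simp add: K_def)
  obtain u v where uv: "\<bar>v\<bar> < e / (K + 1)" "c \<le> a * u + b * v" "c' \<le> a' * u + b' * v"
    using ex[of "e / (K + 1)"] e K by auto
  \<comment> \<open>With these weights \<open>u\<close> cancels, because the signs are opposite;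
    what remains is a multiple of the small \<open>v\<close>.\<close>
  have "\<bar>a\<bar> * c' + \<bar>a'\<bar> * c \<le> \<bar>a\<bar> * (a' * u + b' * v) + \<bar>a'\<bar> * (a * u + b * v)"
    using uv by (intro add_mono mult_left_mono) auto
  also have "\<dots> = (\<bar>a\<bar> * a' + \<bar>a'\<bar> * a) * u + (\<bar>a\<bar> * b' + \<bar>a'\<bar> * b) * v"
    by (simp add: algebra_simps)
  also have "\<bar>a\<bar> * a' + \<bar>a'\<bar> * a = 0"
    using opp by (auto simp: mult_less_0_iff)
  also have "0 * u + (\<bar>a\<bar> * b' + \<bar>a'\<bar> * b) * v \<le> K * \<bar>v\<bar>"
    using abs_ge_self[of "(\<bar>a\<bar> * b' + \<bar>a'\<bar> * b) * v"] by (simp add: K_def abs_mult)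
  also have "\<dots> \<le> K * (e / (K + 1))"
    using uv K by (intro mult_left_mono) auto
  also have "\<dots> \<le> 0 + e"
    using K e by (simp add: field_simps)
  finally show "\<bar>a\<bar> * c' + \<bar>a'\<bar> * c \<le> 0 + e" .
qed

text \<open>If \<open>t \<le> s\<close>, the first inequality yields
  \<open>s d' \<le> t (D - d) \<le> s (D - d)\<close>, and \<open>s\<close> cancels; the other case
  is symmetric.\<close>

lemma add_le_of_weighted:
  fixes s t d d' D :: real
  assumes "0 < s" "0 < t" "0 \<le> d" "0 \<le> d'" "s * d' + t * (d - D) \<le> 0" "t * d + s * (d' - D) \<le> 0"
  shows "d + d' \<le> D"
proof -
  have main: "d + d' \<le> D" if "t \<le> s" "0 < s" "0 < t" "0 \<le> d'" "s * d' + t * (d - D) \<le> 0" for s t d d' :: real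
  proof -
    have "0 \<le> s * d'"
      using that by simp
    then have "0 \<le> t * (D - d)"
      using that(5) by (simp add: right_diff_distrib)
    then have "0 \<le> D - d"
      using that by (simp add: zero_le_mult_iff)
    then have "t * (D - d) \<le> s * (D - d)"
      using that by (intro mult_right_mono)
    then have "s * d' \<le> s * (D - d)"
      using that by (simp add: algebra_simps)
    then show ?thesis
      using that by simp
  qed
  show ?thesis
    using main[of t s d' d] main[of s t d d'] assms by (cases "t \<le> s") auto
qed

text \<open>When the two projections move away from \<open>g\<close> and \<open>h\<close> towards different corners, comparing the
  two half-planes at points of \<open>A\<close> and \<open>B\<close> close to a line through \<open>g\<close>, resp. \<open>h\<close>, shows that \<open>d + d'\<close>
  is small; otherwise only \<open>\<bar>d - d'\<bar>\<close> matters.\<close>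

lemma projections_close:
  fixes \<delta> \<tau> :: real
  assumes A: "convex A" "g \<in> rect_hull A" "f \<in> A" "0 \<le> d" "infnorm (f - g) \<le> d"
    and B: "convex B" "h \<in> rect_hull B" "k \<in> B" "0 \<le> d'" "infnorm (k - h) \<le> d'"
    and gh: "infnorm (g - h) \<le> \<delta>" and \<tau>: "0 \<le> \<tau>"
    and fA: "0 < d \<Longrightarrow> \<exists>a b. a \<noteq> 0 \<and> b \<noteq> 0 \<and> \<bar>a\<bar> + \<bar>b\<bar> = 1 \<and> f = g + (d * sgn a, d * sgn b) \<and>
      (\<forall>p\<in>A. d \<le> a * (fst p - fst g) + b * (snd p - snd g)) \<and>
      (\<forall>p\<in>B. d - \<tau> \<le> a * (fst p - fst g) + b * (snd p - snd g))"
    and kB: "0 < d' \<Longrightarrow> \<exists>a b. a \<noteq> 0 \<and> b \<noteq> 0 \<and> \<bar>a\<bar> + \<bar>b\<bar> = 1 \<and> k = h + (d' * sgn a, d' * sgn b) \<and>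
      (\<forall>p\<in>B. d' \<le> a * (fst p - fst h) + b * (snd p - snd h)) \<and>
      (\<forall>p\<in>A. d' - \<tau> \<le> a * (fst p - fst h) + b * (snd p - snd h))"
  shows "infnorm (f - k) \<le> 2 * \<delta> + \<tau>"
proof -
  have \<delta>: "\<bar>fst g - fst h\<bar> \<le> \<delta>" "\<bar>snd g - snd h\<bar> \<le> \<delta>" "0 \<le> \<delta>"
    using gh by (auto simp: infnorm_plane_le intro: order_trans[OF infnorm_pos_le])
  define D where "D = \<delta> + \<tau>"
  \<comment> \<open>A functional of dual norm 1 changes by at most \<open>\<delta>\<close> when its
    base point moves from \<open>g\<close> to \<open>h\<close>.\<close>
  have shift: "\<bar>a * (fst g - fst h) + b * (snd g - snd h)\<bar> \<le> \<delta>" if "\<bar>a\<bar> + \<bar>b\<bar> = 1" for a b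
  proof -
    have "\<bar>a * (fst g - fst h) + b * (snd g - snd h)\<bar> \<le> \<bar>a\<bar> * \<delta> + \<bar>b\<bar> * \<delta>"
      using \<delta> by (intro order_trans[OF abs_triangle_ineq] add_mono) (simp_all add: abs_mult mult_left_mono)
    then show ?thesis
      using that by (simp flip: distrib_right)
  qed
  have tri: "infnorm (f - k) \<le> infnorm (f - g) + infnorm (g - h) + infnorm (k - h)"
    using infnorm_triangle[of "f - g" "g - h"] infnorm_triangle[of "f - h" "h - k"]
    by (simp add: infnorm_sub[of h k])
  show ?thesis
  proof (cases "0 < d \<and> 0 < d'")
    case False
    \<comment> \<open>At least one projection coincides with its base point; evaluating the other
      half-plane there bounds the remaining distance.\<close>
    have "d + d' \<le> D"
    proof -
      consider "d = 0" "d' = 0" | "d = 0" "0 < d'" | "0 < d" "d' = 0"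
        using False A(4) B(4) by linarith
      then show ?thesis
      proof cases
        case 1
        then show ?thesis
          using \<delta> \<tau> by (simp add: D_def)
      next
        case 2
        then obtain a b where ab: "\<bar>a\<bar> + \<bar>b\<bar> = 1"
          and le: "d' - \<tau> \<le> a * (fst f - fst h) + b * (snd f - snd h)"
          using kB A(3) by blast
        have "f = g"
          using A(5) 2 infnorm_pos_lt[of "f - g"] by simp
        then show ?thesis
          using le shift[OF ab] 2 by (simp add: D_def)
      next
        case 3
        then obtain a b where ab: "\<bar>a\<bar> + \<bar>b\<bar> = 1"
          and le: "d - \<tau> \<le> a * (fst k - fst g) + b * (snd k - snd g)"
          using fA B(3) by blast
        have "k = h"
          using B(5) 3 infnorm_pos_lt[of "k - h"] by simp
        then have "d - \<tau> \<le> - (a * (fst g - fst h) + b * (snd g - snd h))"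
          using le by (simp add: algebra_simps)
        then show ?thesis
          using shift[OF ab] 3 by (simp add: D_def)
      qed
    qed
    then show ?thesis
      using tri gh A(5) B(5) by (simp add: D_def)
  next
    case True
    obtain a b where ab: "a \<noteq> 0" "b \<noteq> 0" "\<bar>a\<bar> + \<bar>b\<bar> = 1" and f: "f = g + (d * sgn a, d * sgn b)"
      and aA: "\<And>p. p \<in> A \<Longrightarrow> d \<le> a * (fst p - fst g) + b * (snd p - snd g)"
      and aB: "\<And>p. p \<in> B \<Longrightarrow> d - \<tau> \<le> a * (fst p - fst g) + b * (snd p - snd g)"
      using fA True by blast
    obtain a' b' where ab': "a' \<noteq> 0" "b' \<noteq> 0" "\<bar>a'\<bar> + \<bar>b'\<bar> = 1" and k: "k = h + (d' * sgn a', d' * sgn b')"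
      and bB: "\<And>p. p \<in> B \<Longrightarrow> d' \<le> a' * (fst p - fst h) + b' * (snd p - snd h)"
      and bA: "\<And>p. p \<in> A \<Longrightarrow> d' - \<tau> \<le> a' * (fst p - fst h) + b' * (snd p - snd h)"
      using kB True by blast
    have aB': "d - D \<le> a * (fst p - fst h) + b * (snd p - snd h)" if "p \<in> B" for p
      using aB[OF that] shift[OF ab(3)] by (simp add: D_def algebra_simps)
    have bA': "d' - D \<le> a' * (fst p - fst g) + b' * (snd p - snd g)" if "p \<in> A" for p
      using bA[OF that] shift[OF ab'(3)] by (simp add: D_def algebra_simps)
    show ?thesis
    proof (cases "a * a' < 0 \<or> b * b' < 0")
      case opp: True
      have "d + d' \<le> D"
      proof (cases "a * a' < 0")
        case True
        have "\<bar>a\<bar> * d' + \<bar>a'\<bar> * (d - D) \<le> 0"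
          using rect_hull_approx(2)[OF B(1,2)] aB' bB by (intro opposite_sign_bound[OF True]) blast
        moreover have "\<bar>a'\<bar> * d + \<bar>a\<bar> * (d' - D) \<le> 0"
          using rect_hull_approx(2)[OF A(1,2)] aA bA'
          by (intro opposite_sign_bound[OF True[unfolded mult.commute[of a]]]) blast
        ultimately show ?thesis
          by (rule add_le_of_weighted[rotated 4]) (use ab(1,2) ab'(1,2) A(4) B(4) in simp_all)
      next
        case False
        then have neg: "b * b' < 0"
          using opp by blast
        \<comment> \<open>The coordinates are exchanged: the points are now close to the vertical
          lines through \<open>h\<close> and \<open>g\<close>.\<close>
        have "\<bar>b\<bar> * d' + \<bar>b'\<bar> * (d - D) \<le> 0"
          using rect_hull_approx(1)[OF B(1,2)] aB' bB
          by (intro opposite_sign_bound[OF neg]) (subst (1 2) add.commute, blast)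
        moreover have "\<bar>b'\<bar> * d + \<bar>b\<bar> * (d' - D) \<le> 0"
          using rect_hull_approx(1)[OF A(1,2)] aA bA'
          by (intro opposite_sign_bound[OF neg[unfolded mult.commute[of b]]]) (subst (1 2) add.commute, blast)
        ultimately show ?thesis
          by (rule add_le_of_weighted[rotated 4]) (use ab(1,2) ab'(1,2) A(4) B(4) in simp_all)
      qed
      then show ?thesis
        using tri gh A(5) B(5) by (simp add: D_def)
    next
      case False
      then have sgn: "sgn a' = sgn a" "sgn b' = sgn b"
        using ab ab' by (auto simp: sgn_real_def not_less zero_le_mult_iff)
      have "d' * (a * sgn a + b * sgn b) = d'" "d * (a' * sgn a' + b' * sgn b') = d"
        using ab ab' by (simp_all flip: abs_sgn)
      \<comment> \<open>The corners are equally oriented, so the half-plane of \<open>f\<close>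
        evaluated at \<open>k\<close> gives \<open>d - D \<le> d'\<close>, and that of
        \<open>k\<close> at \<open>f\<close> gives \<open>d' - D \<le> d\<close>.\<close>
      then have "\<bar>d - d'\<bar> \<le> D"
        using aB'[OF B(3)] bA'[OF A(3)] sgn by (simp add: f k algebra_simps)
      moreover have "f - k = (g - h) + (d - d') *\<^sub>R (sgn a, sgn b)"
        by (simp add: f k sgn prod_eq_iff algebra_simps)
      moreover have "infnorm ((sgn a, sgn b) :: plane) = 1"
        using ab by (simp add: infnorm_plane sgn_real_def)
      ultimately show ?thesis
        using infnorm_triangle[of "g - h" "(d - d') *\<^sub>R (sgn a, sgn b)"] gh
        by (simp add: infnorm_mul D_def del: scaleR_Pair)
    qed
  qed
qed

subsection \<open>Centers of projections of the origin\<close>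

lemma Pr_origin_rectangle:
  assumes R: "is_rectangle R"
  shows "Pr 0 R = (fst ` R \<inter> {- unif_dist 0 R .. unif_dist 0 R}) \<times> (snd ` R \<inter> {- unif_dist 0 R .. unif_dist 0 R})"
    and "fst ` R \<inter> {- unif_dist 0 R .. unif_dist 0 R} \<noteq> {}"
    and "snd ` R \<inter> {- unif_dist 0 R .. unif_dist 0 R} \<noteq> {}"
proof -
  let ?X = "fst ` R \<inter> {- unif_dist 0 R .. unif_dist 0 R}" and ?Y = "snd ` R \<inter> {- unif_dist 0 R .. unif_dist 0 R}"
  have eq: "p \<in> R \<longleftrightarrow> fst p \<in> fst ` R \<and> snd p \<in> snd ` R" for p
    using rectangle_eq_Times(1)[OF R] by (metis mem_Times_iff)
  show Pr_eq: "Pr 0 R = ?X \<times> ?Y"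
  proof (rule set_eqI)
    fix p
    have "infnorm p \<le> e \<longleftrightarrow> fst p \<in> {- e..e} \<and> snd p \<in> {- e..e}" for e
      unfolding infnorm_plane_le atLeastAtMost_iff by linarith
    then show "p \<in> Pr 0 R \<longleftrightarrow> p \<in> ?X \<times> ?Y"
      unfolding mem_Pr mem_Times_iff Int_iff diff_zero eq[of p] by blast
  qed
  obtain s where "s \<in> R" "infnorm (0 - s) = unif_dist 0 R"
    using R unif_dist_attained[of R 0] unfolding is_rectangle_iff by blast
  then have "s \<in> Pr 0 R"
    by (simp add: mem_Pr infnorm_neg)
  then show "?X \<noteq> {}" "?Y \<noteq> {}"
    unfolding Pr_eq by blast+
qed

lemma interval_Int_Icc:
  fixes I :: "real set"
  assumes "closed I" "is_interval I" "I \<inter> {c..d} \<noteq> {}"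
  obtains a b where "I \<inter> {c..d} = {a..b}" "a \<le> b"
proof -
  have "compact (I \<inter> {c..d})" "connected (I \<inter> {c..d})"
    using assms by (auto simp: closed_Int_compact is_interval_connected_1[symmetric] is_interval_cc intro!: is_interval_Int)
  then obtain a b where "I \<inter> {c..d} = {a..b}"
    using connected_compact_interval_1 by blast
  then show thesis
    using that assms(3) by force
qed

lemma closed_segment_axis:
  fixes a b c :: real
  assumes "a \<le> b"
  shows "closed_segment (c, a) (c, b) = {c} \<times> {a..b}" "closed_segment (a, c) (b, c) = {a..b} \<times> {c}"
proof -
  have c: "(1 - u) * c + u * c = c" for u :: real
    by (simp add: algebra_simps)
  have ab: "{a..b} = {(1 - u) * a + u * b |u. 0 \<le> u \<and> u \<le> 1}"
    using closed_segment_eq_real_ivl[of a b] assms by (simp add: closed_segment_def)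
  show "closed_segment (c, a) (c, b) = {c} \<times> {a..b}" "closed_segment (a, c) (b, c) = {a..b} \<times> {c}"
    unfolding ab by (auto simp: closed_segment_def c)
qed

lemma Pr_origin_has_center:
  assumes R: "is_rectangle R"
  shows "\<exists>g. axis_segment_center (Pr (0, 0) R) g"
proof -
  define d where "d = unif_dist 0 R"
  note Pr_eq = Pr_origin_rectangle[OF R, folded d_def]
  obtain a1 b1 where 1: "fst ` R \<inter> {- d..d} = {a1..b1}" "a1 \<le> b1"
    using interval_Int_Icc[OF rectangle_eq_Times(2,3)[OF R] Pr_eq(2)] by blast
  obtain a2 b2 where 2: "snd ` R \<inter> {- d..d} = {a2..b2}" "a2 \<le> b2"
    using interval_Int_Icc[OF rectangle_eq_Times(4,5)[OF R] Pr_eq(3)] by blast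
  have eq: "Pr 0 R = {a1..b1} \<times> {a2..b2}"
    using Pr_eq(1) 1 2 by simp
  have bounds: "- d \<le> a1" "b1 \<le> d" "- d \<le> a2" "b2 \<le> d"
    using 1 2 by (metis IntD2 atLeastAtMost_iff order_refl)+
  \<comment> \<open>Two nondegenerate sides would put the middle of the projection strictly inside
    the square of radius \<open>d\<close>, although \<open>d\<close> is the distance to
    \<open>R\<close>.\<close>
  have "a1 = b1 \<or> a2 = b2"
  proof (rule ccontr)
    assume ne: "\<not> ?thesis"
    define p where "p = ((a1 + b1) / 2, (a2 + b2) / 2)"
    have "infnorm p < d"
      using ne 1(2) 2(2) bounds by (simp add: p_def infnorm_plane_less abs_less_iff)
    moreover have "p \<in> Pr 0 R"
      using 1(2) 2(2) by (simp add: eq p_def)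
    then have "d \<le> infnorm (0 - p)"
      unfolding d_def by (intro unif_dist_le) (simp add: mem_Pr)
    ultimately show False
      by (simp add: infnorm_neg)
  qed
  then have "Pr 0 R = closed_segment (a1, a2) (b1, b2)"
    using closed_segment_axis 1(2) 2(2) eq by (elim disjE) simp_all
  then show ?thesis
    unfolding axis_segment_center_def zero_prod_def[symmetric] using \<open>a1 = b1 \<or> a2 = b2\<close>
    by (intro exI[of _ "midpoint (a1, a2) (b1, b2)"] exI[of _ "(a1, a2)"] exI[of _ "(b1, b2)"]) simp
qed

text \<open>The segment may run in either direction, so its ends are ordered in each coordinate by
  \<open>min\<close> and \<open>max\<close>, which leaves the midpoint unchanged.\<close>

lemma center_coordinates:
  assumes R: "is_rectangle R" and g: "axis_segment_center (Pr (0, 0) R) g"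
  obtains a1 b1 a2 b2 where
    "fst ` R \<inter> {- unif_dist 0 R .. unif_dist 0 R} = {a1..b1}" "a1 \<le> b1" "fst g = (a1 + b1) / 2"
    "snd ` R \<inter> {- unif_dist 0 R .. unif_dist 0 R} = {a2..b2}" "a2 \<le> b2" "snd g = (a2 + b2) / 2"
proof -
  obtain a b where ab: "Pr 0 R = closed_segment a b" "g = midpoint a b"
    using g unfolding axis_segment_center_def zero_prod_def[symmetric] by blast
  have "fst ` Pr 0 R = closed_segment (fst a) (fst b)" "snd ` Pr 0 R = closed_segment (snd a) (snd b)"
    unfolding ab by (simp_all add: closed_segment_linear_image linear_fst linear_snd)
  moreover have "fst ` Pr 0 R = fst ` R \<inter> {- unif_dist 0 R .. unif_dist 0 R}"
    "snd ` Pr 0 R = snd ` R \<inter> {- unif_dist 0 R .. unif_dist 0 R}"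
    using Pr_origin_rectangle[OF R] by (simp_all add: fst_image_times snd_image_times)
  moreover have "closed_segment u v = {min u v .. max u v}" for u v :: real
    by (simp add: closed_segment_eq_real_ivl)
  moreover have "fst g = (min (fst a) (fst b) + max (fst a) (fst b)) / 2"
    "snd g = (min (snd a) (snd b) + max (snd a) (snd b)) / 2"
    unfolding ab by (simp_all add: midpoint_def min_def max_def)
  ultimately show thesis
    by (intro that) (auto simp: min_def max_def)
qed

text \<open>Here \<open>u\<close> stands for an end of a nearby interval truncated at radius
  \<open>e\<close>. If \<open>w\<close> lies beyond the relevant end of the range from
  \<open>- d\<close> to \<open>d\<close>, that end is in \<open>I\<close> by convexity, and
  \<open>e \<le> d + r\<close> takes the place of the bound from \<open>w\<close>.\<close>

lemma truncation_endpoints: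
  fixes I :: "real set"
  assumes I: "is_interval I" "I \<inter> {- d..d} = {a..b}" "a \<le> b"
    and w: "w \<in> I" "\<bar>u - w\<bar> \<le> r" and e: "e \<le> d + r"
  shows "- e \<le> u \<Longrightarrow> a \<le> u + r" "u \<le> e \<Longrightarrow> u - r \<le> b"
proof -
  have mem: "x \<in> I \<and> - d \<le> x \<and> x \<le> d \<longleftrightarrow> a \<le> x \<and> x \<le> b" for x
    using I(2) by (metis IntD1 IntD2 IntI atLeastAtMost_iff)
  have a: "a \<in> I" "- d \<le> a" "a \<le> d" and b: "b \<in> I" "- d \<le> b" "b \<le> d"
    using mem[of a] mem[of b] I(3) by auto
  have conv: "x \<in> I" if "s \<in> I" "t \<in> I" "s \<le> x" "x \<le> t" for s t x
    using I(1) that unfolding is_interval_1 by blast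
  show "a \<le> u + r" if "- e \<le> u"
  proof (cases "w < - d")
    case True
    then have "- d \<in> I"
      using conv[OF w(1) a(1)] a by simp
    then show ?thesis
      using mem[of "- d"] a that e by auto
  next
    case False
    then show ?thesis
      using mem[of w] w a by (cases "w \<le> d") auto
  qed
  show "u - r \<le> b" if "u \<le> e"
  proof (cases "d < w")
    case True
    then have "d \<in> I"
      using conv[OF b(1) w(1)] b by simp
    then show ?thesis
      using mem[of d] b that e by auto
  next
    case False
    then show ?thesis
      using mem[of w] w b by (cases "- d \<le> w") auto
  qed
qed

text \<open>The distances to the origin differ by at most \<open>r\<close>, so in each coordinate
  both ends of the truncated projection move by at most \<open>r\<close>, and the midpoints with
  them.\<close>

lemma centers_close:
  fixes r :: real
  assumes R: "is_rectangle R" "is_rectangle R'" and r: "0 \<le> r"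
    and sub: "R \<subseteq> R' + scaled_Q0 (ennreal r)" "R' \<subseteq> R + scaled_Q0 (ennreal r)"
    and g: "axis_segment_center (Pr (0, 0) R) g" "axis_segment_center (Pr (0, 0) R') g'"
  shows "infnorm (g - g') \<le> r"
proof -
  define d d' where "d = unif_dist 0 R" and "d' = unif_dist 0 R'"
  have near: "\<exists>q\<in>B. infnorm (p - q) \<le> r" if "A \<subseteq> B + scaled_Q0 (ennreal r)" "p \<in> A" for p A B
  proof -
    have "p \<in> B + scaled_Q0 (ennreal r)"
      using that by blast
    then show ?thesis
      using r by (simp add: mem_plus_scaled_Q0)
  qed
  have dist_le: "unif_dist 0 B \<le> unif_dist 0 A + r"
    if A: "is_rectangle A" "A \<subseteq> B + scaled_Q0 (ennreal r)" for A B
  proof -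
    obtain p where p: "p \<in> A" "infnorm (0 - p) = unif_dist 0 A"
      using A(1) unif_dist_attained[of A 0] unfolding is_rectangle_iff by blast
    obtain q where q: "q \<in> B" "infnorm (p - q) \<le> r"
      using near[OF A(2) p(1)] by blast
    have "unif_dist 0 B \<le> infnorm (0 - q)"
      by (rule unif_dist_le[OF q(1)])
    also have "\<dots> \<le> infnorm (0 - p) + infnorm (p - q)"
      using infnorm_triangle[of "0 - p" "p - q"] by simp
    finally show ?thesis
      using p q by simp
  qed
  have d: "d' \<le> d + r" "d \<le> d' + r"
    using dist_le[OF R(1) sub(1)] dist_le[OF R(2) sub(2)] by (simp_all add: d_def d'_def)
  obtain a1 b1 a2 b2 where
    1: "fst ` R \<inter> {- d..d} = {a1..b1}" "a1 \<le> b1" "fst g = (a1 + b1) / 2"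
    and 2: "snd ` R \<inter> {- d..d} = {a2..b2}" "a2 \<le> b2" "snd g = (a2 + b2) / 2"
    using center_coordinates[OF R(1) g(1), folded d_def] by blast
  obtain a1' b1' a2' b2' where
    e1: "fst ` R' \<inter> {- d'..d'} = {a1'..b1'}" "a1' \<le> b1'" "fst g' = (a1' + b1') / 2"
    and e2: "snd ` R' \<inter> {- d'..d'} = {a2'..b2'}" "a2' \<le> b2'" "snd g' = (a2' + b2') / 2"
    using center_coordinates[OF R(2) g(2), folded d'_def] by blast
  have close: "a' \<le> a + r \<and> b - r \<le> b'"
    if hyps: "is_interval I'" "I' \<inter> {- d'..d'} = {a'..b'}" "a' \<le> b'" "I \<inter> {- d..d} = {a..b}" "a \<le> b"
      "\<And>u. u \<in> I \<Longrightarrow> \<exists>w\<in>I'. \<bar>u - w\<bar> \<le> r" "d \<le> d' + r"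
    for I I' :: "real set" and a b a' b' d d'
  proof -
    have "a \<in> I \<inter> {- d..d}" "b \<in> I \<inter> {- d..d}"
      using hyps(4,5) by simp_all
    then have ab: "a \<in> I" "- d \<le> a" "b \<in> I" "b \<le> d"
      by auto
    obtain w w' where "w \<in> I'" "\<bar>a - w\<bar> \<le> r" "w' \<in> I'" "\<bar>b - w'\<bar> \<le> r"
      using hyps(6) ab by blast
    then show ?thesis
      using truncation_endpoints[OF hyps(1-3)] hyps(7) ab by blast
  qed
  have near_fst: "\<exists>w\<in>fst ` B. \<bar>u - w\<bar> \<le> r" if hyps: "A \<subseteq> B + scaled_Q0 (ennreal r)" "u \<in> fst ` A" for u A B
  proof -
    obtain p where p: "p \<in> A" "u = fst p"
      using hyps(2) by blast
    then obtain q where "q \<in> B" "infnorm (p - q) \<le> r"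
      using near[OF hyps(1)] by blast
    then show ?thesis
      using p(2) by (intro bexI[of _ "fst q"]) (simp_all add: infnorm_plane_le)
  qed
  have near_snd: "\<exists>w\<in>snd ` B. \<bar>u - w\<bar> \<le> r" if hyps: "A \<subseteq> B + scaled_Q0 (ennreal r)" "u \<in> snd ` A" for u A B
  proof -
    obtain p where p: "p \<in> A" "u = snd p"
      using hyps(2) by blast
    then obtain q where "q \<in> B" "infnorm (p - q) \<le> r"
      using near[OF hyps(1)] by blast
    then show ?thesis
      using p(2) by (intro bexI[of _ "snd q"]) (simp_all add: infnorm_plane_le)
  qed
  note iv = rectangle_eq_Times(3,5)
  have "a1' \<le> a1 + r \<and> b1 - r \<le> b1'"
    by (rule close[OF iv(1)[OF R(2)] e1(1,2) 1(1,2) near_fst[OF sub(1)] d(2)])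
  moreover have "a2' \<le> a2 + r \<and> b2 - r \<le> b2'"
    by (rule close[OF iv(2)[OF R(2)] e2(1,2) 2(1,2) near_snd[OF sub(1)] d(2)])
  moreover have "a1 \<le> a1' + r \<and> b1' - r \<le> b1"
    by (rule close[OF iv(1)[OF R(1)] 1(1,2) e1(1,2) near_fst[OF sub(2)] d(1)])
  moreover have "a2 \<le> a2' + r \<and> b2' - r \<le> b2"
    by (rule close[OF iv(2)[OF R(1)] 2(1,2) e2(1,2) near_snd[OF sub(2)] d(1)])
  ultimately show ?thesis
    using 1(3) 2(3) e1(3) e2(3) by (simp add: infnorm_plane_le abs_le_iff)
qed

section \<open>Half-planes containing inflated sets\<close>

lemma halfplane_radius_finite:
  fixes a b c :: real and g :: plane
  assumes "A \<noteq> {}" "a \<noteq> 0"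
    and le: "\<And>p. p \<in> A + scaled_Q0 t \<Longrightarrow> c \<le> a * (fst p - fst g) + b * (snd p - snd g)"
  shows "t \<noteq> \<infinity>"
proof
  assume "t = \<infinity>"
  \<comment> \<open>At this point the functional equals \<open>c - 1\<close>.\<close>
  then have "(fst g + (c - 1) / a, snd g) \<in> A + scaled_Q0 t"
    using plus_scaled_Q0_top[OF assms(1)] by simp
  from le[OF this] show False
    using assms(2) by simp
qed

text \<open>On the square of radius \<open>s\<close> around a point \<open>q\<close> of
  \<open>A\<close> the functional drops to exactly \<open>s\<close> below its value at
  \<open>q\<close>, so it is at least \<open>c + s\<close> on \<open>A\<close>; inflating
  \<open>A\<close> by \<open>t\<close> loses at most \<open>t\<close>.\<close>

lemma halfplane_change_radius:
  fixes a b c s t :: real and g :: plane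
  assumes "0 \<le> s" "0 \<le> t" and ab: "\<bar>a\<bar> + \<bar>b\<bar> = 1"
    and le: "\<And>p. p \<in> A + scaled_Q0 (ennreal s) \<Longrightarrow> c \<le> a * (fst p - fst g) + b * (snd p - snd g)"
    and p: "p \<in> A + scaled_Q0 (ennreal t)"
  shows "c + s - t \<le> a * (fst p - fst g) + b * (snd p - snd g)"
proof -
  obtain q where q: "q \<in> A" "infnorm (p - q) \<le> t"
    using p assms(2) by (auto simp: mem_plus_scaled_Q0)
  have "q - (s * sgn a, s * sgn b) \<in> A + scaled_Q0 (ennreal s)"
    unfolding mem_plus_scaled_Q0
  proof (intro bexI[OF _ q(1)] ennreal_leI)
    have "q - (s * sgn a, s * sgn b) - q = - (s * sgn a, s * sgn b)"
      by (simp add: prod_eq_iff)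
    then show "infnorm (q - (s * sgn a, s * sgn b) - q) \<le> s"
      using infnorm_corner[OF assms(1), of a b] by (simp only: infnorm_neg)
  qed
  from le[OF this] have "c \<le> a * (fst q - fst g) + b * (snd q - snd g) - s * (a * sgn a + b * sgn b)"
    by (simp add: algebra_simps)
  moreover have "a * sgn a + b * sgn b = 1"
    using ab by (simp flip: abs_sgn)
  moreover have "\<bar>a * (fst p - fst q) + b * (snd p - snd q)\<bar> \<le> \<bar>a\<bar> * t + \<bar>b\<bar> * t"
    using q(2) by (intro order_trans[OF abs_triangle_ineq] add_mono)
      (simp_all add: abs_mult mult_left_mono infnorm_plane_le)
  moreover have "\<bar>a\<bar> * t + \<bar>b\<bar> * t = t"
    using ab by (simp flip: distrib_right)
  ultimately show ?thesis
    by (simp add: algebra_simps)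
qed

subsection \<open>The algorithm\<close>

lemma refinement_Inter: "refinement M \<rho> F l x = \<Inter>((\<lambda>y. F y + scaled_Q0 (scaled l (\<rho> x y))) ` M)"
  by (simp add: refinement_def)

lemma refinement_subset_summand:
  "y \<in> M \<Longrightarrow> refinement M \<rho> F l x \<subseteq> F y + scaled_Q0 (scaled l (\<rho> x y))"
  by (auto simp: refinement_def)

lemma refinement_subset:
  assumes "ext_pseudometric_on M \<rho>" "x \<in> M"
  shows "refinement M \<rho> F l x \<subseteq> F x"
proof -
  have "\<rho> x x = 0"
    using assms unfolding ext_pseudometric_on_def by blast
  then show ?thesis
    using refinement_subset_summand[of x M \<rho> F l x] assms(2) by (simp add: plus_scaled_Q0_zero)
qed

lemma scaled_triangle:
  assumes "ext_pseudometric_on M \<rho>" "x \<in> M" "y \<in> M" "z \<in> M"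
  shows "scaled l (\<rho> x z) \<le> scaled l (\<rho> x y) + scaled l (\<rho> y z)"
proof -
  have "\<rho> x z \<le> \<rho> x y + \<rho> y z"
    using assms unfolding ext_pseudometric_on_def by blast
  then show ?thesis
    using scaled_mono scaled_add by metis
qed

lemma plus_scaled_Q0_subset_add:
  assumes "r \<le> s + t"
  shows "A + scaled_Q0 r \<subseteq> (A + scaled_Q0 s) + scaled_Q0 t"
proof -
  have "scaled_Q0 r \<subseteq> scaled_Q0 (s + t)"
    using assms by (auto simp: mem_scaled_Q0)
  also have "\<dots> \<subseteq> scaled_Q0 s + scaled_Q0 t"
    by (rule scaled_Q0_add)
  finally show ?thesis
    by (subst add.assoc) (rule set_plus_mono2[OF order_refl])
qed

lemma is_rectangle_refinement:
  assumes "\<And>y. y \<in> M \<Longrightarrow> is_rectangle (T y)" "refinement M \<rho> T l x \<noteq> {}"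
  shows "is_rectangle (refinement M \<rho> T l x)"
  unfolding refinement_Inter
proof (rule is_rectangle_Inter)
  show "is_rectangle R" if "R \<in> (\<lambda>y. T y + scaled_Q0 (scaled l (\<rho> x y))) ` M" for R
    using that assms(1) is_rectangle_plus_scaled_Q0 by blast
qed (use assms(2) in \<open>simp add: refinement_Inter\<close>)

text \<open>By \<open>Helly_rectangle\<close> two summands at a time suffice. The triangle
  inequality through \<open>x\<close> cuts the step from \<open>T z\<close> to \<open>p\<close> in
  two, and the intermediate point \<open>q\<close> lies in both summands.\<close>

lemma rectangle_refinement_nonempty:
  assumes M: "finite M" "ext_pseudometric_on M \<rho>"
    and T: "\<And>y. y \<in> M \<Longrightarrow> is_rectangle (T y)"
    and meet: "\<And>y z. y \<in> M \<Longrightarrow> z \<in> M \<Longrightarrow> T y \<inter> (T z + scaled_Q0 (scaled l (\<rho> y z))) \<noteq> {}"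
    and x: "x \<in> M"
  shows "refinement M \<rho> T l x \<noteq> {}"
  unfolding refinement_Inter
proof (rule Helly_rectangle)
  fix R R'
  assume "R \<in> (\<lambda>y. T y + scaled_Q0 (scaled l (\<rho> x y))) ` M" "R' \<in> (\<lambda>y. T y + scaled_Q0 (scaled l (\<rho> x y))) ` M"
  then obtain y z where yz: "y \<in> M" "z \<in> M"
    and R: "R = T y + scaled_Q0 (scaled l (\<rho> x y))" "R' = T z + scaled_Q0 (scaled l (\<rho> x z))"
    by blast
  obtain p where p: "p \<in> T y" "p \<in> T z + scaled_Q0 (scaled l (\<rho> y z))"
    using meet[OF yz] by blast
  have "\<rho> y x = \<rho> x y"
    using M(2) x yz unfolding ext_pseudometric_on_def by blast
  then have "scaled l (\<rho> y z) \<le> scaled l (\<rho> x z) + scaled l (\<rho> x y)"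
    using scaled_triangle[OF M(2) yz(1) x yz(2), of l] by (simp add: add.commute)
  then have "p \<in> (T z + scaled_Q0 (scaled l (\<rho> x z))) + scaled_Q0 (scaled l (\<rho> x y))"
    using p(2) plus_scaled_Q0_subset_add by blast
  then obtain q where q: "q \<in> T z + scaled_Q0 (scaled l (\<rho> x z))" "ennreal (infnorm (p - q)) \<le> scaled l (\<rho> x y)"
    unfolding mem_plus_scaled_Q0[of p] by blast
  have "q \<in> T y + scaled_Q0 (scaled l (\<rho> x y))"
    unfolding mem_plus_scaled_Q0 using p(1) q(2) by (intro bexI[of _ p]) (simp_all add: infnorm_sub)
  then show "R \<inter> R' \<noteq> {}"
    using q(1) R by blast
qed (use M T in \<open>auto intro: is_rectangle_plus_scaled_Q0\<close>)

text \<open>Each summand moves by at most \<open>scaled l (\<rho> x y)\<close> by the triangle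
  inequality; \<open>Inter_plus_scaled_Q0\<close> carries this over to the intersection.\<close>

lemma rectangle_refinement_subset:
  assumes M: "finite M" "ext_pseudometric_on M \<rho>"
    and T: "\<And>y. y \<in> M \<Longrightarrow> is_rectangle (T y)"
    and xy: "x \<in> M" "y \<in> M" and ne: "refinement M \<rho> T l y \<noteq> {}"
  shows "refinement M \<rho> T l x \<subseteq> refinement M \<rho> T l y + scaled_Q0 (scaled l (\<rho> x y))"
proof
  fix p assume p: "p \<in> refinement M \<rho> T l x"
  show "p \<in> refinement M \<rho> T l y + scaled_Q0 (scaled l (\<rho> x y))"
    unfolding refinement_Inter[of M \<rho> T l y]
  proof (rule Inter_plus_scaled_Q0)
    fix R assume "R \<in> (\<lambda>z. T z + scaled_Q0 (scaled l (\<rho> y z))) ` M"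
    then obtain z where z: "z \<in> M" "R = T z + scaled_Q0 (scaled l (\<rho> y z))"
      by blast
    show "is_rectangle R"
      using z T by (auto intro: is_rectangle_plus_scaled_Q0)
    have "p \<in> T z + scaled_Q0 (scaled l (\<rho> x z))"
      using p refinement_subset_summand[OF z(1)] by blast
    moreover have "scaled l (\<rho> x z) \<le> scaled l (\<rho> y z) + scaled l (\<rho> x y)"
      using scaled_triangle[OF M(2) xy z(1), of l] by (simp add: add.commute)
    ultimately show "p \<in> R + scaled_Q0 (scaled l (\<rho> x y))"
      using plus_scaled_Q0_subset_add z(2) by blast
  qed (use M ne in \<open>simp_all add: refinement_Inter\<close>)
qed

text \<open>This supplies the half-planes for \<open>projections_close\<close>. The member found by
  \<open>Pr_Inter\<close> is some \<open>F z\<close> inflated for \<open>x\<close>; the refinement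
  at \<open>y\<close> lies in the same \<open>F z\<close> inflated for \<open>y\<close>, with a
  radius larger by at most \<open>l * t\<close>.\<close>

lemma projection_on_refinement:
  assumes M: "finite M" "ext_pseudometric_on M \<rho>"
    and F: "\<And>z. z \<in> M \<Longrightarrow> F z \<noteq> {} \<and> convex (F z) \<and> closed (F z)"
    and xy: "x \<in> M" "y \<in> M" "\<rho> x y = ennreal t" "0 \<le> t" and l: "0 \<le> l"
    and g: "g \<in> rect_hull (refinement M \<rho> F l x)" and f: "Pr g (refinement M \<rho> F l x) = {f}"
    and d: "d = unif_dist g (refinement M \<rho> F l x)" "0 < d"
  shows "\<exists>a b. a \<noteq> 0 \<and> b \<noteq> 0 \<and> \<bar>a\<bar> + \<bar>b\<bar> = 1 \<and> f = g + (d * sgn a, d * sgn b) \<and>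
    (\<forall>p\<in>refinement M \<rho> F l x. d \<le> a * (fst p - fst g) + b * (snd p - snd g)) \<and>
    (\<forall>p\<in>refinement M \<rho> F l y. d - l * t \<le> a * (fst p - fst g) + b * (snd p - snd g))"
proof -
  define K where "K x z = F z + scaled_Q0 (scaled l (\<rho> x z))" for x z
  have K: "refinement M \<rho> F l x = \<Inter>(K x ` M)" for x
    unfolding K_def by (rule refinement_Inter)
  obtain C a b where C: "C \<in> K x ` M" and ab: "a \<noteq> 0" "b \<noteq> 0" "\<bar>a\<bar> + \<bar>b\<bar> = 1"
    and far: "\<And>p. p \<in> C \<Longrightarrow> d \<le> a * (fst p - fst g) + b * (snd p - snd g)"
    and Pr: "Pr g (refinement M \<rho> F l x) = {g + (d * sgn a, d * sgn b)}"
  proof (rule Pr_Inter[of "K x ` M" g])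
    show "convex C" "closed C" if "C \<in> K x ` M" for C
      using that F unfolding K_def
      by (auto intro: convex_set_plus convex_scaled_Q0 closed_plus_scaled_Q0)
  qed (use M g d in \<open>auto simp: K\<close>)
  obtain z where z: "z \<in> M" "C = K x z"
    using C by blast
  have far_z: "d \<le> a * (fst p - fst g) + b * (snd p - snd g)" if "p \<in> F z + scaled_Q0 (scaled l (\<rho> x z))" for p
    using far that z(2) by (simp add: K_def)
  have "F z \<noteq> {}"
    using F z by blast
  \<comment> \<open>A set inside a half-plane is not the whole plane, so \<open>z\<close> has finite
    distance from \<open>x\<close>, and then also from \<open>y\<close>.\<close>
  from halfplane_radius_finite[OF this ab(1) far_z] have "scaled l (\<rho> x z) \<noteq> \<infinity>" .
  then have "\<rho> x z \<noteq> \<infinity>"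
    unfolding scaled_def by metis
  then obtain s where s: "\<rho> x z = ennreal s" "0 \<le> s"
    by (cases "\<rho> x z") simp_all
  have "\<rho> y z \<le> \<rho> y x + \<rho> x z" "\<rho> y x = \<rho> x y"
    using M(2) xy z(1) unfolding ext_pseudometric_on_def by blast+
  then have le: "\<rho> y z \<le> ennreal (t + s)"
    using xy(3,4) s by simp
  then obtain s' where s': "\<rho> y z = ennreal s'" "0 \<le> s'"
    by (cases "\<rho> y z") (auto simp: top_unique)
  have "s' \<le> t + s"
    using le s s' xy(4) by (simp flip: ennreal_plus)
  then have lss: "l * s' \<le> l * t + l * s"
    using mult_left_mono[of s' "t + s" l] l by (simp add: distrib_left)
  have "d - l * t \<le> a * (fst p - fst g) + b * (snd p - snd g)" if "p \<in> refinement M \<rho> F l y" for p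
  proof -
    have "p \<in> F z + scaled_Q0 (ennreal (l * s'))"
      using subsetD[OF refinement_subset_summand[OF z(1)] that] by (simp only: scaled_ennreal[OF l s'(2)] s'(1))
    then have "d + l * s - l * s' \<le> a * (fst p - fst g) + b * (snd p - snd g)"
      using far_z s s' l ab(3) scaled_ennreal[OF l s(2)]
      by (intro halfplane_change_radius[of "l * s" "l * s'" a b "F z"]) simp_all
    then show ?thesis
      using lss by simp
  qed
  moreover have "refinement M \<rho> F l x \<subseteq> C"
    using z by (auto simp: K)
  ultimately show ?thesis
    using ab far Pr f by (intro exI[of _ a] exI[of _ b]) auto
qed

lemma refinement_hull:
  assumes M: "finite M" "ext_pseudometric_on M \<rho>"
    and F: "\<And>z. z \<in> M \<Longrightarrow> convex (F z) \<and> closed (F z)"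
    and W: "\<And>x' x'' y' y''. x' \<in> M \<Longrightarrow> x'' \<in> M \<Longrightarrow> y' \<in> M \<Longrightarrow> y'' \<in> M \<Longrightarrow>
      W \<rho> F l x x' x'' \<inter> W \<rho> F l x y' y'' \<noteq> {}"
    and x: "x \<in> M"
  shows "refinement M \<rho> F l x \<noteq> {}"
    and "step2_rect M \<rho> F l x = (\<Inter>x'\<in>M. \<Inter>x''\<in>M. W \<rho> F l x x' x'')"
proof -
  define K where "K z = F z + scaled_Q0 (scaled l (\<rho> x z))" for z
  have sym: "\<rho> z x = \<rho> x z" if "z \<in> M" for z
    using M(2) x that unfolding ext_pseudometric_on_def by blast
  have WK: "W \<rho> F l x x' x'' = rect_hull (K x' \<inter> K x'')" if "x' \<in> M" "x'' \<in> M" for x' x''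
    using that by (simp add: W_def K_def sym)
  have 1: "finite (K ` M)" "K ` M \<noteq> {}"
    using M x by auto
  have 2: "convex C" "closed C" if "C \<in> K ` M" for C
    using that F unfolding K_def
    by (auto intro: convex_set_plus convex_scaled_Q0 closed_plus_scaled_Q0)
  have 3: "rect_hull (A \<inter> B) \<inter> rect_hull (A' \<inter> B') \<noteq> {}"
    if AB: "A \<in> K ` M" "B \<in> K ` M" "A' \<in> K ` M" "B' \<in> K ` M" for A B A' B'
  proof -
    obtain x' x'' y' y'' where "x' \<in> M" "x'' \<in> M" "y' \<in> M" "y'' \<in> M"
      "A = K x'" "B = K x''" "A' = K y'" "B' = K y''"
      using AB by blast
    then show ?thesis
      using W[of x' x'' y' y''] WK by simp
  qed
  note hull = rect_hull_Inter[OF 1 2 3]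
  show "refinement M \<rho> F l x \<noteq> {}"
    using hull(1) by (simp add: refinement_def K_def)
  show "step2_rect M \<rho> F l x = (\<Inter>x'\<in>M. \<Inter>x''\<in>M. W \<rho> F l x x' x'')"
    using hull(2) WK by (simp add: step2_rect_def refinement_def K_def)
qed

theorem theorem1p12:
  fixes M :: "'a set" and \<rho> :: "'a \<Rightarrow> 'a \<Rightarrow> ennreal" and F :: "'a \<Rightarrow> plane set"
    and lt l :: real
  assumes "finite M" and "ext_pseudometric_on M \<rho>"
    and "\<forall>x\<in>M. F x \<noteq> {} \<and> convex (F x) \<and> closed (F x)"
    and "0 \<le> lt" and "0 \<le> l"
    and "\<forall>x\<in>M. \<forall>x'\<in>M. \<forall>x''\<in>M. \<forall>y\<in>M. \<forall>y'\<in>M. \<forall>y''\<in>M.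
           W \<rho> F lt x x' x'' \<inter> (W \<rho> F lt y y' y'' + scaled_Q0 (scaled l (\<rho> x y))) \<noteq> {}"
  shows "(\<exists>f. proj_algorithm M \<rho> F lt l (Success f)) \<and>
         (\<forall>out. proj_algorithm M \<rho> F lt l out \<longrightarrow>
           (\<exists>f. out = Success f \<and> lipschitz_selection M \<rho> F f \<and>
                lip_norm M \<rho> f \<le> ennreal (2 * l + lt)))"
proof -
  note M = assms(1,2)
  have \<rho>_refl: "\<rho> x x = 0" if "x \<in> M" for x
    using M(2) that unfolding ext_pseudometric_on_def by blast
  have \<rho>_sym: "\<rho> x y = \<rho> y x" if "x \<in> M" "y \<in> M" for x y
    using M(2) that unfolding ext_pseudometric_on_def by blast
  have F: "F x \<noteq> {} \<and> convex (F x) \<and> closed (F x)" if "x \<in> M" for x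
    using assms(3) that by blast
  have WW: "W \<rho> F lt x x' x'' \<inter> (W \<rho> F lt y y' y'' + scaled_Q0 (scaled l (\<rho> x y))) \<noteq> {}"
    if "x \<in> M" "x' \<in> M" "x'' \<in> M" "y \<in> M" "y' \<in> M" "y'' \<in> M" for x x' x'' y y' y''
    using assms(6) that by blast
  have W_same: "W \<rho> F lt x x' x'' \<inter> W \<rho> F lt x y' y'' \<noteq> {}"
    if "x \<in> M" "x' \<in> M" "x'' \<in> M" "y' \<in> M" "y'' \<in> M" for x x' x'' y' y''
    using WW[of x x' x'' x y' y''] that by (simp add: \<rho>_refl plus_scaled_Q0_zero)
  have W_rect: "is_rectangle (W \<rho> F lt x x' x'')" if "x \<in> M" "x' \<in> M" "x'' \<in> M" for x x' x''
    using W_same[of x x' x'' x' x''] that unfolding W_def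
    by (metis Int_empty_left is_rectangle_rect_hull(1) rect_hull_def)
  define F1 T T1 where "F1 = refinement M \<rho> F lt" and "T = step2_rect M \<rho> F lt" and "T1 = refinement M \<rho> T l"
  have F_cc: "convex (F z) \<and> closed (F z)" if "z \<in> M" for z
    using F[OF that] by blast
  have F1_ne: "F1 x \<noteq> {}"
    and T_eq: "T x = (\<Inter>x'\<in>M. \<Inter>x''\<in>M. W \<rho> F lt x x' x'')" if x: "x \<in> M" for x
    unfolding F1_def T_def
    by (rule refinement_hull[OF M F_cc W_same[OF x] x]; assumption)+
  have F1_convex: "convex (F1 x)" and F1_closed: "closed (F1 x)" for x
    unfolding F1_def refinement_def using F_cc
    by (auto intro!: convex_INT closed_INT ballI convex_set_plus convex_scaled_Q0 closed_plus_scaled_Q0)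
  have T_hull: "T x = rect_hull (F1 x)" for x
    by (simp add: T_def F1_def step2_rect_def)
  have T_rect: "is_rectangle (T x)" if "x \<in> M" for x
    using is_rectangle_rect_hull(1)[OF F1_ne[OF that]] by (simp add: T_hull)
  \<comment> \<open>The rectangles \<open>W\<close> at \<open>y\<close> and the inflated ones at
    \<open>z\<close> meet pairwise, so they have a common point; \<open>Inter_plus_scaled_Q0\<close>
    then takes the inflation out of the intersection.\<close>
  have T_meet: "T y \<inter> (T z + scaled_Q0 (scaled l (\<rho> y z))) \<noteq> {}" if yz: "y \<in> M" "z \<in> M" for y z
  proof -
    define \<W> where "\<W> x = (\<lambda>(x', x''). W \<rho> F lt x x' x'') ` (M \<times> M)" for x
    have T_Inter: "T x = \<Inter>(\<W> x)" if "x \<in> M" for x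
      using T_eq[OF that] by (auto simp: \<W>_def)
    have fin: "finite (\<W> x)" for x
      using M by (simp add: \<W>_def)
    have rect: "is_rectangle R" if "x \<in> M" "R \<in> \<W> x" for x R
      using that W_rect by (auto simp: \<W>_def)
    define Q where "Q = scaled_Q0 (scaled l (\<rho> y z))"
    have meet1: "R \<inter> R' \<noteq> {}" if "x \<in> M" "R \<in> \<W> x" "R' \<in> \<W> x" for x R R'
      using that W_same by (auto simp: \<W>_def)
    have meet2: "R \<inter> (R' + Q) \<noteq> {}" if "R \<in> \<W> y" "R' \<in> \<W> z" for R R'
      using that WW yz by (auto simp: \<W>_def Q_def)
    have meet3: "(R + Q) \<inter> (R' + Q) \<noteq> {}" if "R \<in> \<W> z" "R' \<in> \<W> z" for R R'
      using meet1[OF yz(2) that] subset_plus_scaled_Q0[of R "scaled l (\<rho> y z)"]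
        subset_plus_scaled_Q0[of R' "scaled l (\<rho> y z)"] unfolding Q_def by blast
    have "\<Inter>(\<W> y \<union> (\<lambda>R. R + Q) ` \<W> z) \<noteq> {}"
    proof (rule Helly_rectangle)
      show "is_rectangle R" if "R \<in> \<W> y \<union> (\<lambda>R. R + Q) ` \<W> z" for R
        using that rect yz unfolding Q_def by (auto intro: is_rectangle_plus_scaled_Q0)
      fix R R' assume "R \<in> \<W> y \<union> (\<lambda>R. R + Q) ` \<W> z" "R' \<in> \<W> y \<union> (\<lambda>R. R + Q) ` \<W> z"
      then show "R \<inter> R' \<noteq> {}"
        using meet1[OF yz(1)] meet2 meet3 by (elim UnE imageE) (simp_all add: Int_commute)
    qed (use fin in simp)
    then obtain p where p: "p \<in> \<Inter>(\<W> y)" "\<And>R. R \<in> \<W> z \<Longrightarrow> p \<in> R + Q"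
      by blast
    have "p \<in> \<Inter>(\<W> z) + Q"
      unfolding Q_def
    proof (rule Inter_plus_scaled_Q0[OF fin])
      show "\<Inter>(\<W> z) \<noteq> {}"
        using T_rect[OF yz(2)] T_Inter[OF yz(2)] by (simp add: is_rectangle_iff)
    qed (use rect yz p(2) in \<open>auto simp: Q_def\<close>)
    then show ?thesis
      using p(1) T_Inter yz by (auto simp: Q_def)
  qed
  have T1_ne: "T1 x \<noteq> {}" if "x \<in> M" for x
    unfolding T1_def using rectangle_refinement_nonempty[OF M T_rect T_meet that] by blast
  have T1_rect: "is_rectangle (T1 x)" if "x \<in> M" for x
    unfolding T1_def using is_rectangle_refinement[OF T_rect] T1_ne[OF that] by (simp add: T1_def)
  \<comment> \<open>The summand for \<open>x\<close> itself in Step 3 has radius 0 and puts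
    \<open>g\<close> into \<open>T x\<close>, the hull of \<open>F1 x\<close>. This makes the
    projection to \<open>F1 x\<close> a single point.\<close>
  have g_hull: "g \<in> rect_hull (F1 x)" if x: "x \<in> M" and g: "axis_segment_center (Pr (0, 0) (T1 x)) g" for x g
  proof -
    have "g \<in> Pr (0, 0) (T1 x)"
      using g midpoint_in_closed_segment unfolding axis_segment_center_def by metis
    then have "g \<in> T1 x"
      by (simp add: Pr_def)
    then show ?thesis
      using refinement_subset[OF M(2) x, of T l] by (auto simp: T1_def T_hull)
  qed
  have exists: "\<exists>f. proj_algorithm M \<rho> F lt l (Success f)"
  proof -
    have "\<forall>x\<in>M. \<exists>g. axis_segment_center (Pr (0, 0) (T1 x)) g"
      using Pr_origin_has_center T1_rect by blast
    then obtain g where g: "\<forall>x\<in>M. axis_segment_center (Pr (0, 0) (T1 x)) (g x)"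
      by metis
    have "\<exists>f. Pr (g x) (F1 x) = {f}" if "x \<in> M" for x
      using Pr_singleton[OF F1_convex F1_closed g_hull[OF that]] g that by blast
    then obtain f where "\<forall>x\<in>M. Pr (g x) (F1 x) = {f x}"
      by (metis (mono_tags))
    then have "proj_algorithm M \<rho> F lt l (Success f)"
      using F1_ne T1_ne g unfolding F1_def T1_def T_def by (intro proj_algorithm.success) auto
    then show ?thesis
      by blast
  qed
  have lip: "lipschitz_selection M \<rho> F f \<and> lip_norm M \<rho> f \<le> ennreal (2 * l + lt)"
    if g: "\<And>x. x \<in> M \<Longrightarrow> axis_segment_center (Pr (0, 0) (T1 x)) (g x)"
      and f: "\<And>x. x \<in> M \<Longrightarrow> Pr (g x) (F1 x) = {f x}" for f g
  proof -
    have f_mem: "f x \<in> F1 x" "infnorm (f x - g x) \<le> unif_dist (g x) (F1 x)" if "x \<in> M" for x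
      using f[OF that] mem_Pr[of "f x" "g x" "F1 x"] by simp_all
    have f_lip: "ennreal (infnorm (f x - f y)) \<le> scaled (2 * l + lt) (\<rho> x y)" if xy: "x \<in> M" "y \<in> M" for x y
    proof (cases "\<rho> x y")
      case top
      then show ?thesis
        by (simp add: scaled_def)
    next
      case (real t)
      have sub: "T1 u \<subseteq> T1 v + scaled_Q0 (ennreal (l * t))" if "u \<in> M" "v \<in> M" "\<rho> u v = ennreal t" for u v
        using rectangle_refinement_subset[of M \<rho> T u v l, OF M T_rect that(1,2)] T1_ne[OF that(2)] that(3)
          scaled_ennreal[OF assms(5) real(1)] by (simp add: T1_def)
      have yx: "\<rho> y x = ennreal t"
        using real \<rho>_sym xy by simp
      have gg: "infnorm (g x - g y) \<le> l * t"
        using xy real yx assms(5)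
        by (intro centers_close[OF T1_rect[OF xy(1)] T1_rect[OF xy(2)] _ sub sub g g]) simp_all
      \<comment> \<open>The centers move by at most \<open>l * t\<close> and the half-planes by
        \<open>lt * t\<close>; twice the first plus the second is
        \<open>(2 * l + lt) * t\<close>.\<close>
      have "infnorm (f x - f y) \<le> 2 * (l * t) + lt * t"
      proof (rule projections_close)
        show "convex (F1 x)" "convex (F1 y)"
          by (rule F1_convex)+
        show "g x \<in> rect_hull (F1 x)" "g y \<in> rect_hull (F1 y)"
          using g_hull g xy by blast+
        show "f x \<in> F1 x" "infnorm (f x - g x) \<le> unif_dist (g x) (F1 x)"
          "f y \<in> F1 y" "infnorm (f y - g y) \<le> unif_dist (g y) (F1 y)"
          using f_mem xy by blast+
        show "0 \<le> unif_dist (g x) (F1 x)" "0 \<le> unif_dist (g y) (F1 y)"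
          using unif_dist_nonneg F1_ne xy by blast+
        show "infnorm (g x - g y) \<le> l * t" "0 \<le> lt * t"
          using gg assms(4) real by simp_all
      next
        assume "0 < unif_dist (g x) (F1 x)"
        then show "\<exists>a b. a \<noteq> 0 \<and> b \<noteq> 0 \<and> \<bar>a\<bar> + \<bar>b\<bar> = 1 \<and>
            f x = g x + (unif_dist (g x) (F1 x) * sgn a, unif_dist (g x) (F1 x) * sgn b) \<and>
            (\<forall>p\<in>F1 x. unif_dist (g x) (F1 x) \<le> a * (fst p - fst (g x)) + b * (snd p - snd (g x))) \<and>
            (\<forall>p\<in>F1 y. unif_dist (g x) (F1 x) - lt * t \<le> a * (fst p - fst (g x)) + b * (snd p - snd (g x)))"
          unfolding F1_def
          using projection_on_refinement[OF M F xy real(2,1) assms(4) g_hull[OF xy(1) g[OF xy(1)], unfolded F1_def]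
              f[OF xy(1), unfolded F1_def] refl] by blast
      next
        assume "0 < unif_dist (g y) (F1 y)"
        then show "\<exists>a b. a \<noteq> 0 \<and> b \<noteq> 0 \<and> \<bar>a\<bar> + \<bar>b\<bar> = 1 \<and>
            f y = g y + (unif_dist (g y) (F1 y) * sgn a, unif_dist (g y) (F1 y) * sgn b) \<and>
            (\<forall>p\<in>F1 y. unif_dist (g y) (F1 y) \<le> a * (fst p - fst (g y)) + b * (snd p - snd (g y))) \<and>
            (\<forall>p\<in>F1 x. unif_dist (g y) (F1 y) - lt * t \<le> a * (fst p - fst (g y)) + b * (snd p - snd (g y)))"
          unfolding F1_def
          using projection_on_refinement[OF M F xy(2,1) yx real(1) assms(4) g_hull[OF xy(2) g[OF xy(2)], unfolded F1_def]
              f[OF xy(2), unfolded F1_def] refl] by blast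
      qed
      then have "ennreal (infnorm (f x - f y)) \<le> ennreal ((2 * l + lt) * t)"
        by (intro ennreal_leI) (simp add: algebra_simps)
      also have "\<dots> = scaled (2 * l + lt) (\<rho> x y)"
        using assms(4,5) real by (simp add: scaled_ennreal)
      finally show ?thesis .
    qed
    have "lip_norm M \<rho> f \<le> ennreal (2 * l + lt)"
      unfolding lip_norm_def using f_lip assms(4,5)
      by (intro Inf_lower CollectI exI[of _ "2 * l + lt"]) (simp del: ennreal_plus)
    moreover have "ennreal (2 * l + lt) < \<infinity>"
      by simp
    moreover have "f x \<in> F x" if "x \<in> M" for x
      using refinement_subset[OF M(2) that, of F lt] f_mem(1)[OF that] by (auto simp: F1_def)
    ultimately show ?thesis
      unfolding lipschitz_selection_def by (metis order_le_less_trans)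
  qed
  have "\<exists>f. out = Success f \<and> lipschitz_selection M \<rho> F f \<and> lip_norm M \<rho> f \<le> ennreal (2 * l + lt)"
    if "proj_algorithm M \<rho> F lt l out" for out
    using that
  proof cases
    case no_go_step1
    then show ?thesis
      using F1_ne by (auto simp: F1_def)
  next
    case no_go_step3
    then show ?thesis
      using T1_ne by (auto simp: T1_def T_def)
  next
    case (success g f)
    then show ?thesis
      using lip[of g f] by (simp add: F1_def T1_def T_def)
  qed
  with exists show ?thesis
    by blast
qed

end
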